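(* Let $p_3>0$, $p_1=\frac13p_3$, $\rho>0$, and consider the system $$\mathcal{D}'=2\mathcal{I}(p_1\mathcal{D}-p_3\mathcal{R}),\qquad\mathcal{R}'=2\mathcal{I}(p_1\mathcal{R}-p_3\mathcal{D}),\qquad\mathcal{I}'=-2p_1(\mathcal{D}^2+\mathcal{R}^2)+4p_3\mathcal{D}\mathcal{R}$$ on $S^2_\rho$. Let $c_\pm:=\frac12(\mathcal{D}(0)\mp\mathcal{R}(0))^2$. (1) If $c_+=0=c_-$, then $(\mathcal{D},\mathcal{R},\mathcal{I})(\tau)=(0,0,\pm\rho)$ (constant, with the sign of $\mathcal{I}(0)$). (2) If $c_+=0<c_-$, then $$\mathcal{D}(\tau)=\mathcal{R}(\tau)=(\operatorname{sign}\mathcal{D}(0))\tfrac{\rho}{\sqrt2\cosh(\frac43p_3\rho\tau+\tau_0)},\qquad\mathcal{I}(\tau)=\rho\tanh(\tfrac43p_3\rho\tau+\tau_0),$$ where $\tau_0=\tanh^{-1}\frac{\mathcal{I}(0)}{\rho}=(\operatorname{sign}\mathcal{I}(0))\cosh^{-1}\frac{\rho}{\sqrt2|\mathcal{D}(0)|}$. (3) If $c_+>0=c_-$, then $$\mathcal{D}(\tau)=-\mathcal{R}(\tau)=(\operatorname{sign}\mathcal{D}(0))\tfrac{\rho}{\sqrt2\cosh(\frac83p_3\rho\tau-\tau_0)},\qquad\mathcal{I}(\tau)=-\rho\tanh(\tfrac83p_3\rho\tau-\tau_0),$$ where $\tau_0=\tanh^{-1}\frac{\mathcal{I}(0)}{\rho}=(\operatorname{sign}\mathcal{I}(0))\cosh^{-1}\frac{\rho}{\sqrt2|\mathcal{D}(0)|}$.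 (4) If $c_+,c_->0$ and $\mathcal{I}(0)=0$, there are three subcases. (4a) If $2c_+=c_-$, then the solution is constant, and the constant is one of $\pm\big(\frac{\sqrt2-1}{\sqrt6}\rho,\frac{\sqrt2+1}{\sqrt6}\rho,0\big)$, $\pm\big(\frac{\sqrt2+1}{\sqrt6}\rho,\frac{\sqrt2-1}{\sqrt6}\rho,0\big)$. (4b) If $2c_+>c_-$, let $\alpha=-\frac12-\frac{\sqrt{c_+(c_++4c_-)}}{2c_+}\in(-2,-1)$ and $\beta=-\frac12+\frac{\sqrt{c_+(c_++4c_-)}}{2c_+}\in(0,1)$ be the two roots of $c_+w^2+c_+w-c_-=0$. With $m=\frac{-\alpha(1-\beta)}{\beta-\alpha}$, $u=\frac43p_3\sqrt{c_+(\beta-\alpha)}\,\tau$ and $w(\tau)=\frac{\beta}{1-(1-\beta)\operatorname{cd}^2(u,m)}$, $$\mathcal{D}(\tau)=\tfrac{\mathcal{D}(0)+\mathcal{R}(0)}{2}w(\tau)^{-\frac12}+\tfrac{\mathcal{D}(0)-\mathcal{R}(0)}{2}w(\tau),\qquad\mathcal{R}(\tau)=\tfrac{\mathcal{D}(0)+\mathcal{R}(0)}{2}w(\tau)^{-\frac12}-\tfrac{\mathcal{D}(0)-\mathcal{R}(0)}{2}w(\tau),$$ $$\mathcal{I}(\tau)=-\sqrt{\tfrac{c_+}{\beta-\alpha}}\,\beta(1-\alpha)(1-\beta)\,\tfrac{\operatorname{cd}(u,m)\operatorname{sd}(u,m)\operatorname{nd}(u,m)}{1-(1-\beta)\operatorname{cd}^2(u,m)}.$$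 (4c) If $2c_+<c_-$, let $\alpha=-\frac12-\frac{\sqrt{c_+(c_++4c_-)}}{2c_+}<-2$ and $\gamma=-\frac12+\frac{\sqrt{c_+(c_++4c_-)}}{2c_+}>1$ be the two roots of $c_+w^2+c_+w-c_-=0$. With $m=\frac{(\gamma-1)(-\alpha)}{\gamma(1-\alpha)}$, $u=\frac43p_3\sqrt{c_+\gamma(1-\alpha)}\,\tau$ and $w(\tau)=\frac{\gamma}{\gamma-(\gamma-1)\operatorname{sn}^2(u,m)}$, $$\mathcal{D}(\tau)=\tfrac{\mathcal{D}(0)+\mathcal{R}(0)}{2}w(\tau)^{-\frac12}+\tfrac{\mathcal{D}(0)-\mathcal{R}(0)}{2}w(\tau),\qquad\mathcal{R}(\tau)=\tfrac{\mathcal{D}(0)+\mathcal{R}(0)}{2}w(\tau)^{-\frac12}-\tfrac{\mathcal{D}(0)-\mathcal{R}(0)}{2}w(\tau),$$ $$\mathcal{I}(\tau)=\sqrt{c_+\gamma(1-\alpha)}\,(\gamma-1)\,\tfrac{\operatorname{sn}(u,m)\operatorname{cn}(u,m)\operatorname{dn}(u,m)}{\gamma-(\gamma-1)\operatorname{sn}^2(u,m)}.$$ (5) If $c_+,c_->0$ and $\mathcal{I}(0)\ne0$, let $\alpha\in(-\infty,0)$, $\beta\in(0,1)$, $\gamma>1$ be the three roots of $-c_+w^3+\rho^2w-c_-=0$. With $m=\frac{(\gamma-\beta)(-\alpha)}{\gamma(\beta-\alpha)}$, $\tau_0=\operatorname{sign}(\mathcal{I}(0))\operatorname{sn}^{-1}\Big(\sqrt{\frac{\gamma(1-\beta)}{\gamma-\beta}},m\Big)$,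 $u=\frac43p_3\sqrt{c_+\gamma(\beta-\alpha)}\,\tau+\tau_0$ and $w(\tau)=\frac{\beta\gamma}{\gamma-(\gamma-\beta)\operatorname{sn}^2(u,m)}$, $$\mathcal{D}(\tau)=\tfrac{\mathcal{D}(0)+\mathcal{R}(0)}{2}w(\tau)^{-\frac12}+\tfrac{\mathcal{D}(0)-\mathcal{R}(0)}{2}w(\tau),\qquad\mathcal{R}(\tau)=\tfrac{\mathcal{D}(0)+\mathcal{R}(0)}{2}w(\tau)^{-\frac12}-\tfrac{\mathcal{D}(0)-\mathcal{R}(0)}{2}w(\tau),$$ $$\mathcal{I}(\tau)=\sqrt{c_+\gamma(\beta-\alpha)}\,(\gamma-\beta)\,\tfrac{\operatorname{sn}(u,m)\operatorname{cn}(u,m)\operatorname{dn}(u,m)}{\gamma-(\gamma-\beta)\operatorname{sn}^2(u,m)}.$$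
   Context: $S^2_\rho=\{(x,y,z)\in\mathbb{R}^3: x^2+y^2+z^2=\rho^2\}$; the unknown $(\mathcal{D},\mathcal{R},\mathcal{I})$ is real valued with initial data in $S_\rho^2$, and the system preserves $S^2_\rho$. Jacobi elliptic functions with parameter $m\in[0,1)$: for $u\in\mathbb{R}$ define $\phi$ by $u=\int_0^\phi\frac{d\theta}{\sqrt{1-m\sin^2\theta}}$; then $\operatorname{sn}(u,m)=\sin\phi$, $\operatorname{cn}(u,m)=\cos\phi$, $\operatorname{dn}(u,m)=\sqrt{1-m\sin^2\phi}$, and $\operatorname{cd}=\operatorname{cn}/\operatorname{dn}$, $\operatorname{sd}=\operatorname{sn}/\operatorname{dn}$, $\operatorname{nd}=1/\operatorname{dn}$. $\operatorname{sn}^{-1}(\cdot,m)$ is the inverse of $\operatorname{sn}(\cdot,m)$ on $[0,K(m)]$, $K(m)=\int_0^{\pi/2}\frac{d\theta}{\sqrt{1-m\sin^2\theta}}$. *)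

theory Defs
  imports "HOL-Analysis.Analysis"
begin

definition sphere2 :: "real \<Rightarrow> (real \<times> real \<times> real) set" where
  "sphere2 \<rho> = {(x, y, z). x\<^sup>2 + y\<^sup>2 + z\<^sup>2 = \<rho>\<^sup>2}"

text \<open>
  The derivatives are taken within \<open>J\<close>, so they are one-sided at an endpoint of \<open>J\<close> that
  belongs to \<open>J\<close>, and ordinary derivatives if \<open>J\<close> is open (in particular if \<open>J = UNIV\<close>).
\<close>

definition solves_system ::
  "real \<Rightarrow> real \<Rightarrow> real set \<Rightarrow> (real \<Rightarrow> real) \<Rightarrow> (real \<Rightarrow> real) \<Rightarrow> (real \<Rightarrow> real) \<Rightarrow> bool" where
  "solves_system p1 p3 J D R I \<longleftrightarrow> (\<forall>t\<in>J.
     (D has_real_derivative 2 * I t * (p1 * D t - p3 * R t)) (at t within J) \<and>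
     (R has_real_derivative 2 * I t * (p1 * R t - p3 * D t)) (at t within J) \<and>
     (I has_real_derivative - 2 * p1 * ((D t)\<^sup>2 + (R t)\<^sup>2) + 4 * p3 * D t * R t) (at t within J))"

text \<open>
  Jacobi elliptic functions, with the parameter \<open>m\<close> (not the modulus) as second argument.
  They are meaningful for \<open>0 \<le> m < 1\<close>, where \<open>\<lambda>\<phi>. ellint_F \<phi> m\<close> is a bijection of the reals.
  The integral is oriented: it is negative for \<open>\<phi> < 0\<close>.
\<close>

definition ellint_F :: "real \<Rightarrow> real \<Rightarrow> real" where
  "ellint_F \<phi> m = (LBINT \<theta>=ereal 0..ereal \<phi>. 1 / sqrt (1 - m * (sin \<theta>)\<^sup>2))"

definition ellint_K :: "real \<Rightarrow> real" where
  "ellint_K m = ellint_F (pi / 2) m"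

definition jacobi_am :: "real \<Rightarrow> real \<Rightarrow> real" where
  "jacobi_am u m = (THE \<phi>. u = ellint_F \<phi> m)"

definition jacobi_sn :: "real \<Rightarrow> real \<Rightarrow> real" where
  "jacobi_sn u m = sin (jacobi_am u m)"

definition jacobi_cn :: "real \<Rightarrow> real \<Rightarrow> real" where
  "jacobi_cn u m = cos (jacobi_am u m)"

definition jacobi_dn :: "real \<Rightarrow> real \<Rightarrow> real" where
  "jacobi_dn u m = sqrt (1 - m * (sin (jacobi_am u m))\<^sup>2)"

definition jacobi_cd :: "real \<Rightarrow> real \<Rightarrow> real" where
  "jacobi_cd u m = jacobi_cn u m / jacobi_dn u m"

definition jacobi_sd :: "real \<Rightarrow> real \<Rightarrow> real" where
  "jacobi_sd u m = jacobi_sn u m / jacobi_dn u m"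

definition jacobi_nd :: "real \<Rightarrow> real \<Rightarrow> real" where
  "jacobi_nd u m = 1 / jacobi_dn u m"

definition jacobi_sn_inv :: "real \<Rightarrow> real \<Rightarrow> real" where
  "jacobi_sn_inv y m = the_inv_into {0..ellint_K m} (\<lambda>u. jacobi_sn u m) y"

end

theory Submission
  imports Defs
begin

text \<open>
  In the variables \<open>S = D + R\<close> and \<open>T = D - R\<close> the system reads
  \<open>S' = - 4/3 p3 I S\<close>, \<open>T' = 8/3 p3 I T\<close>, \<open>I' = 2/3 p3 (S\<^sup>2 - 2 T\<^sup>2)\<close>.
  Hence \<open>T = T(0) w\<close> and \<open>S = S(0) w powr (-1/2)\<close> with \<open>w' = 8/3 p3 I w\<close>, and conservation of
  \<open>D\<^sup>2 + R\<^sup>2 + I\<^sup>2\<close> turns this into \<open>w'\<^sup>2 = (8/3 p3)\<^sup>2 w (- cp w\<^sup>3 + \<rho>\<^sup>2 w - cm)\<close>, which is solved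
  by Jacobi functions in terms of the roots of the cubic. Since \<open>I\<close> may vanish, the quadratic
  relation does not determine the solution; instead each formula is checked to satisfy the first
  order system, and the claim follows from uniqueness. The formulas with \<open>sn\<close> and \<open>cd\<close> are
  the same computation, because \<open>q = sn\<close> and \<open>q = cd\<close> satisfy the same equations
  \<open>q'\<^sup>2 = (1 - q\<^sup>2) (1 - m q\<^sup>2)\<close> and \<open>q'' = - (1 + m) q + 2 m q\<^sup>3\<close>; the roots
  \<open>\<beta> = 1\<close> or \<open>\<gamma> = 1\<close> give the cases with \<open>I(0) = 0\<close>.
\<close>

subsection \<open>Uniqueness\<close>

text \<open>By the bound, \<open>E x * exp (- C * x)\<close> is nonincreasing and
  \<open>E x * exp (C * x)\<close> is nondecreasing. The first forces \<open>E t \<le> 0\<close> for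
  times after \<open>a\<close>, the second for times before \<open>a\<close>.\<close>

lemma gronwall_zero:
  fixes E E' :: "real \<Rightarrow> real"
  assumes J: "is_interval J" "a \<in> J" "t \<in> J"
    and der: "\<And>x. x \<in> J \<Longrightarrow> (E has_real_derivative E' x) (at x within J)"
    and bound: "\<And>x. x \<in> J \<Longrightarrow> \<bar>E' x\<bar> \<le> C * E x"
    and nonneg: "\<And>x. x \<in> J \<Longrightarrow> E x \<ge> 0"
    and zero: "E a = 0"
  shows "E t = 0"
proof -
  define c d where "c = min a t" and "d = max a t"
  have cd: "c \<le> d" by (simp add: c_def d_def)
  have sub: "{c..d} \<subseteq> J"
  proof
    fix x assume "x \<in> {c..d}"
    moreover have "c \<in> J" "d \<in> J" using J(2,3) unfolding c_def d_def by (simp_all add: min_def max_def)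
    ultimately show "x \<in> J" using mem_is_interval_1_I[OF J(1), of c d x] by simp
  qed
  have der_exp: "((\<lambda>x. E x * exp (k * x)) has_real_derivative (E' x + k * E x) * exp (k * x)) (at x within J)"
    if "x \<in> J" for x k
    by (rule derivative_eq_intros der[OF that] refl)+ (simp add: algebra_simps)
  have cont: "continuous_on {c..d} (\<lambda>x. E x * exp (k * x))" for k
    by (rule continuous_on_subset[OF _ sub]) (rule DERIV_continuous_on[OF der_exp])
  \<comment> \<open>On the open interval the derivative within \<open>J\<close> is two-sided. At
    \<open>c\<close> and \<open>d\<close>, which may be endpoints of \<open>J\<close>, the
    monotonicity rules ask for continuity only.\<close>
  have der_open: "((\<lambda>x. E x * exp (k * x)) has_real_derivative (E' x + k * E x) * exp (k * x)) (at x)"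
    if "c < x" "x < d" for x k
  proof -
    have "x \<in> interior J"
      using that sub by (intro interiorI[of "{c<..<d}"]) auto
    then show ?thesis
      using der_exp[of x k] at_within_interior[of x J] interior_subset[of J] by (metis subsetD)
  qed
  have "E d * exp (- C * d) \<le> E c * exp (- C * c)"
  proof (rule DERIV_nonpos_imp_decreasing_open[where f = "\<lambda>x. E x * exp (- C * x)"])
    fix x assume x: "c < x" "x < d"
    then have "x \<in> J" using sub by auto
    then have "(E' x + - C * E x) * exp (- C * x) \<le> 0"
      using bound[of x] by (auto simp: mult_le_0_iff)
    then show "\<exists>y. ((\<lambda>x. E x * exp (- C * x)) has_real_derivative y) (at x) \<and> y \<le> 0"
      using der_open[OF x] by blast
  qed (use cd cont[of "- C"] in simp_all)
  moreover have "E c * exp (C * c) \<le> E d * exp (C * d)"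
  proof (rule DERIV_nonneg_imp_increasing_open[where f = "\<lambda>x. E x * exp (C * x)"])
    fix x assume x: "c < x" "x < d"
    then have "x \<in> J" using sub by auto
    then have "(E' x + C * E x) * exp (C * x) \<ge> 0"
      using bound[of x] by auto
    then show "\<exists>y. ((\<lambda>x. E x * exp (C * x)) has_real_derivative y) (at x) \<and> y \<ge> 0"
      using der_open[OF x] by blast
  qed (use cd cont[of C] in simp_all)
  ultimately have "E t \<le> 0"
    using zero by (cases "a \<le> t") (simp_all add: c_def d_def mult_le_0_iff)
  then show ?thesis
    using nonneg[OF J(3)] by simp
qed

text \<open>The contributions of \<open>D\<close> and \<open>R\<close> to the derivative of the sum
  of squares cancel that of \<open>I\<close>, for arbitrary \<open>p1\<close> and
  \<open>p3\<close>.\<close>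

lemma solves_system_conserved:
  assumes "solves_system p1 p3 J D R I" "is_interval J" "a \<in> J" "t \<in> J"
  shows "(D t)\<^sup>2 + (R t)\<^sup>2 + (I t)\<^sup>2 = (D a)\<^sup>2 + (R a)\<^sup>2 + (I a)\<^sup>2"
proof -
  have "((\<lambda>t. (D t)\<^sup>2 + (R t)\<^sup>2 + (I t)\<^sup>2) has_real_derivative 0) (at x within J)" if "x \<in> J" for x
  proof -
    have "(D has_real_derivative 2 * I x * (p1 * D x - p3 * R x)) (at x within J)"
      "(R has_real_derivative 2 * I x * (p1 * R x - p3 * D x)) (at x within J)"
      "(I has_real_derivative - 2 * p1 * ((D x)\<^sup>2 + (R x)\<^sup>2) + 4 * p3 * D x * R x) (at x within J)"
      using assms(1) that unfolding solves_system_def by blast+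
    then show ?thesis
      by (auto intro!: derivative_eq_intros simp: algebra_simps power2_eq_square)
  qed
  then obtain c where "\<And>x. x \<in> J \<Longrightarrow> (D x)\<^sup>2 + (R x)\<^sup>2 + (I x)\<^sup>2 = c"
    using has_field_derivative_zero_constant[of J "\<lambda>t. (D t)\<^sup>2 + (R t)\<^sup>2 + (I t)\<^sup>2"]
      is_interval_convex[OF assms(2)] by blast
  then show ?thesis using assms(3,4) by simp
qed

text \<open>Gronwall's argument for a squared distance of the two solutions. Equal initial data put
  both on one sphere, whose radius \<open>B\<close> bounds \<open>I\<close> and \<open>I'\<close>
  and hence the coefficient in the differential inequality.\<close>

lemma solves_system_unique:
  assumes sol: "solves_system p1 p3 J D R I" "solves_system p1 p3 J D' R' I'"
    and J: "is_interval J" "a \<in> J" "t \<in> J"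
    and init: "D' a = D a" "R' a = R a" "I' a = I a"
  shows "D t = D' t \<and> R t = R' t \<and> I t = I' t"
proof -
  define B where "B = sqrt ((D a)\<^sup>2 + (R a)\<^sup>2 + (I a)\<^sup>2)"
  define E where "E x = 2 * ((D x - D' x)\<^sup>2 + (R x - R' x)\<^sup>2) + (I x - I' x)\<^sup>2" for x
  \<comment> \<open>with the weight 2 the factor \<open>I + I'\<close> splits off the derivative, and only it needs a bound\<close>
  define E' where "E' x = 2 * (I x + I' x) *
    ((p1 + p3) * (D x - D' x - (R x - R' x))\<^sup>2 - (p3 - p1) * (D x - D' x + (R x - R' x))\<^sup>2)" for x
  have B: "\<bar>I x\<bar> \<le> B" "\<bar>I' x\<bar> \<le> B" if "x \<in> J" for x
  proof -
    have "B\<^sup>2 = (D x)\<^sup>2 + (R x)\<^sup>2 + (I x)\<^sup>2" "B\<^sup>2 = (D' x)\<^sup>2 + (R' x)\<^sup>2 + (I' x)\<^sup>2"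
      using solves_system_conserved[OF sol(1) J(1,2) that]
        solves_system_conserved[OF sol(2) J(1,2) that] init by (simp_all add: B_def)
    moreover have "(D x)\<^sup>2 \<ge> 0" "(R x)\<^sup>2 \<ge> 0" "(D' x)\<^sup>2 \<ge> 0" "(R' x)\<^sup>2 \<ge> 0" by simp_all
    ultimately have "(I x)\<^sup>2 \<le> B\<^sup>2" "(I' x)\<^sup>2 \<le> B\<^sup>2" by linarith+
    moreover have "B \<ge> 0" by (simp add: B_def)
    ultimately show "\<bar>I x\<bar> \<le> B" "\<bar>I' x\<bar> \<le> B"
      using power2_le_imp_le[of "\<bar>I x\<bar>" B] power2_le_imp_le[of "\<bar>I' x\<bar>" B] by simp_all
  qed
  have "E t = 0"
  proof (rule gronwall_zero[OF J, of E E' "4 * B * (\<bar>p1 + p3\<bar> + \<bar>p3 - p1\<bar>)"])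
    fix x assume x: "x \<in> J"
    have "(D has_real_derivative 2 * I x * (p1 * D x - p3 * R x)) (at x within J)"
      "(R has_real_derivative 2 * I x * (p1 * R x - p3 * D x)) (at x within J)"
      "(I has_real_derivative - 2 * p1 * ((D x)\<^sup>2 + (R x)\<^sup>2) + 4 * p3 * D x * R x) (at x within J)"
      "(D' has_real_derivative 2 * I' x * (p1 * D' x - p3 * R' x)) (at x within J)"
      "(R' has_real_derivative 2 * I' x * (p1 * R' x - p3 * D' x)) (at x within J)"
      "(I' has_real_derivative - 2 * p1 * ((D' x)\<^sup>2 + (R' x)\<^sup>2) + 4 * p3 * D' x * R' x) (at x within J)"
      using sol x unfolding solves_system_def by blast+
    then show "(E has_real_derivative E' x) (at x within J)"
      unfolding E_def E'_def
      by (auto intro!: derivative_eq_intros) algebra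
    \<comment> \<open>The squared differences of the two solutions in the variables
      \<open>D + R\<close> and \<open>D - R\<close>. In these terms \<open>E\<close> is
      \<open>s2 + t2\<close> plus the squared difference in \<open>I\<close>, and \<open>E'\<close>
      is \<open>I + I'\<close> times a linear combination of \<open>s2\<close> and
      \<open>t2\<close>.\<close>
    define s2 t2 where "s2 = (D x - D' x + (R x - R' x))\<^sup>2" and "t2 = (D x - D' x - (R x - R' x))\<^sup>2"
    have pos: "s2 \<ge> 0" "t2 \<ge> 0" by (auto simp: s2_def t2_def)
    have "s2 + t2 = 2 * ((D x - D' x)\<^sup>2 + (R x - R' x)\<^sup>2)"
      unfolding s2_def t2_def by algebra
    then have E: "s2 + t2 \<le> E x" by (simp add: E_def)
    have "\<bar>(p1 + p3) * t2 - (p3 - p1) * s2\<bar> \<le> \<bar>(p1 + p3) * t2\<bar> + \<bar>(p3 - p1) * s2\<bar>"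
      by (rule abs_triangle_ineq4)
    also have "\<dots> = \<bar>p1 + p3\<bar> * t2 + \<bar>p3 - p1\<bar> * s2"
      using pos by (simp add: abs_mult)
    also have "\<dots> \<le> (\<bar>p1 + p3\<bar> + \<bar>p3 - p1\<bar>) * (s2 + t2)"
      using pos by (simp add: algebra_simps)
    also have "\<dots> \<le> (\<bar>p1 + p3\<bar> + \<bar>p3 - p1\<bar>) * E x"
      using E by (intro mult_left_mono) auto
    finally have 1: "\<bar>(p1 + p3) * t2 - (p3 - p1) * s2\<bar> \<le> (\<bar>p1 + p3\<bar> + \<bar>p3 - p1\<bar>) * E x" .
    have "\<bar>2 * (I x + I' x)\<bar> \<le> 4 * B"
      using abs_triangle_ineq[of "I x" "I' x"] B[OF x] by (simp add: abs_mult del: abs_triangle_ineq)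
    then have "\<bar>2 * (I x + I' x)\<bar> * \<bar>(p1 + p3) * t2 - (p3 - p1) * s2\<bar>
        \<le> (4 * B) * ((\<bar>p1 + p3\<bar> + \<bar>p3 - p1\<bar>) * E x)"
      using 1 B(1)[OF x] by (intro mult_mono) auto
    then show "\<bar>E' x\<bar> \<le> 4 * B * (\<bar>p1 + p3\<bar> + \<bar>p3 - p1\<bar>) * E x"
      unfolding E'_def s2_def t2_def by (simp add: abs_mult mult.assoc)
  qed (use init in \<open>auto simp: E_def\<close>)
  then show ?thesis
    unfolding E_def by (simp add: add_nonneg_eq_0_iff)
qed

subsection \<open>Jacobi elliptic functions\<close>

lemma one_minus_sin_squared_pos:
  fixes m \<phi> :: real
  assumes "0 \<le> m" "m < 1"
  shows "1 - m * (sin \<phi>)\<^sup>2 > 0"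
proof -
  have "m * (sin \<phi>)\<^sup>2 \<le> m * 1"
    using assms by (intro mult_left_mono) (auto simp: abs_square_le_1)
  then show ?thesis using assms by linarith
qed

lemma ellint_F_has_derivative:
  assumes m: "0 \<le> m" "m < 1"
  shows "((\<lambda>\<phi>. ellint_F \<phi> m) has_real_derivative 1 / sqrt (1 - m * (sin \<phi>)\<^sup>2)) (at \<phi>)"
proof -
  define f where "f = (\<lambda>\<theta>::real. 1 / sqrt (1 - m * (sin \<theta>)\<^sup>2))"
  have cont: "continuous_on A f" for A
    unfolding f_def using one_minus_sin_squared_pos[OF m]
    by (auto intro!: continuous_intros simp: less_imp_neq[symmetric])
  \<comment> \<open>Both the base point 0 and \<open>\<phi>\<close> lie strictly inside this compact
    interval, so the fundamental theorem covers either sign of \<open>\<phi>\<close> and yields a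
    two-sided derivative.\<close>
  define lo hi where "lo = min 0 \<phi> - 1" and "hi = max 0 \<phi> + 1"
  have "((\<lambda>u. LBINT y=0..u. f y) has_vector_derivative (f \<phi>)) (at \<phi> within {lo..hi})"
    using interval_integral_FTC2[of lo 0 hi f \<phi>] by (auto simp: lo_def hi_def cont zero_ereal_def)
  then have "((\<lambda>u. LBINT y=0..u. f y) has_vector_derivative (f \<phi>)) (at \<phi>)"
    by (subst (asm) at_within_interior) (auto simp: lo_def hi_def)
  then show ?thesis
    unfolding ellint_F_def f_def by (simp add: has_real_derivative_iff_has_vector_derivative zero_ereal_def)
qed

lemma ellint_F_0 [simp]: "ellint_F 0 m = 0"
  by (simp add: ellint_F_def)

lemma ellint_F_strict_mono:
  assumes m: "0 \<le> m" "m < 1"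
  shows "strict_mono (\<lambda>\<phi>. ellint_F \<phi> m)"
proof (rule strict_monoI)
  fix x y :: real assume "x < y"
  then show "ellint_F x m < ellint_F y m"
    by (rule DERIV_pos_imp_increasing)
      (use ellint_F_has_derivative[OF m] one_minus_sin_squared_pos[OF m] in \<open>force intro!: exI conjI\<close>)
qed

text \<open>The integrand is at least 1, so \<open>ellint_F \<phi> m - \<phi>\<close> is
  nondecreasing, and it vanishes at 0. Hence \<open>u\<close> lies between the values at
  \<open>- \<bar>u\<bar>\<close> and \<open>\<bar>u\<bar>\<close>.\<close>

lemma ellint_F_surj:
  assumes m: "0 \<le> m" "m < 1"
  shows "\<exists>\<phi>. ellint_F \<phi> m = u"
proof -
  have cont: "isCont (\<lambda>\<phi>. ellint_F \<phi> m) x" for x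
    using ellint_F_has_derivative[OF m] DERIV_isCont by blast
  have mono: "ellint_F x m - x \<le> ellint_F y m - y" if "x \<le> y" for x y
  proof (rule DERIV_nonneg_imp_nondecreasing[OF that], intro exI conjI)
    fix z
    show "((\<lambda>\<phi>. ellint_F \<phi> m - \<phi>) has_real_derivative 1 / sqrt (1 - m * (sin z)\<^sup>2) - 1) (at z)"
      by (rule derivative_intros ellint_F_has_derivative[OF m])+
    have "sqrt (1 - m * (sin z)\<^sup>2) \<le> 1"
      using m by simp
    then show "0 \<le> 1 / sqrt (1 - m * (sin z)\<^sup>2) - 1"
      using one_minus_sin_squared_pos[OF m, of z] by simp
  qed
  have "\<exists>x. - \<bar>u\<bar> \<le> x \<and> x \<le> \<bar>u\<bar> \<and> ellint_F x m = u"
    by (rule IVT) (use mono[of "- \<bar>u\<bar>" 0] mono[of 0 "\<bar>u\<bar>"] cont in auto)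
  then show ?thesis by blast
qed

context
  fixes m :: real
  assumes m: "0 \<le> m" "m < 1"
begin

lemma ellint_F_jacobi_am: "ellint_F (jacobi_am u m) m = u"
proof -
  have "\<exists>!\<phi>. u = ellint_F \<phi> m"
    using ellint_F_surj[OF m, of u] strict_mono_eq[OF ellint_F_strict_mono[OF m]] by metis
  from theI'[OF this] show ?thesis unfolding jacobi_am_def by simp
qed

lemma jacobi_am_ellint_F: "jacobi_am (ellint_F \<phi> m) m = \<phi>"
  using ellint_F_jacobi_am[of "ellint_F \<phi> m"] strict_mono_eq[OF ellint_F_strict_mono[OF m]] by simp

lemma jacobi_am_0: "jacobi_am 0 m = 0"
  using jacobi_am_ellint_F[of 0] by simp

lemma jacobi_dn_pos: "jacobi_dn u m > 0"
  unfolding jacobi_dn_def using one_minus_sin_squared_pos[OF m] by simp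

text \<open>The amplitude inverts \<open>ellint_F\<close>, whose derivative there is
  \<open>1 / dn\<close>. The inverse function rule presupposes continuity of the inverse, which is
  established first.\<close>

lemma jacobi_am_has_derivative:
  "((\<lambda>u. jacobi_am u m) has_real_derivative jacobi_dn u m) (at u)"
proof -
  have "isCont (\<lambda>u. jacobi_am u m) (ellint_F (jacobi_am u m) m)"
    by (rule isCont_inverse_function[where d = 1])
      (use ellint_F_has_derivative[OF m] DERIV_isCont jacobi_am_ellint_F in auto)
  then have "isCont (\<lambda>u. jacobi_am u m) u"
    by (simp add: ellint_F_jacobi_am)
  then have "((\<lambda>u. jacobi_am u m) has_real_derivative
      inverse (1 / sqrt (1 - m * (sin (jacobi_am u m))\<^sup>2))) (at u)"
    using one_minus_sin_squared_pos[OF m, of "jacobi_am u m"]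
    by (intro DERIV_inverse_function[where a = "u - 1" and b = "u + 1", OF ellint_F_has_derivative[OF m]])
      (auto simp: ellint_F_jacobi_am)
  then show ?thesis by (simp add: jacobi_dn_def)
qed

lemma jacobi_dn_squared: "(jacobi_dn u m)\<^sup>2 = 1 - m * (jacobi_sn u m)\<^sup>2"
  using one_minus_sin_squared_pos[OF m, of "jacobi_am u m"] by (simp add: jacobi_dn_def jacobi_sn_def)

lemma jacobi_sn_has_derivative:
  "((\<lambda>u. jacobi_sn u m) has_real_derivative jacobi_cn u m * jacobi_dn u m) (at u)"
  unfolding jacobi_sn_def jacobi_cn_def
  by (rule derivative_eq_intros jacobi_am_has_derivative refl)+

lemma jacobi_cn_has_derivative:
  "((\<lambda>u. jacobi_cn u m) has_real_derivative - jacobi_sn u m * jacobi_dn u m) (at u)"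
  unfolding jacobi_sn_def jacobi_cn_def
  by (rule derivative_eq_intros jacobi_am_has_derivative refl | simp)+

lemma jacobi_dn_has_derivative:
  "((\<lambda>u. jacobi_dn u m) has_real_derivative - m * jacobi_sn u m * jacobi_cn u m) (at u)"
proof -
  have "((\<lambda>u. sqrt (1 - m * (jacobi_sn u m)\<^sup>2)) has_real_derivative
     (inverse (sqrt (1 - m * (jacobi_sn u m)\<^sup>2)) / 2) *
     (- m * (2 * jacobi_sn u m * (jacobi_cn u m * jacobi_dn u m)))) (at u)"
  proof (rule DERIV_chain2[where f = sqrt, OF DERIV_real_sqrt])
    show "0 < 1 - m * (jacobi_sn u m)\<^sup>2"
      unfolding jacobi_sn_def by (rule one_minus_sin_squared_pos[OF m])
  qed (rule derivative_eq_intros jacobi_sn_has_derivative refl | simp)+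
  moreover have "sqrt (1 - m * (jacobi_sn u m)\<^sup>2) = jacobi_dn u m"
    by (simp add: jacobi_dn_def jacobi_sn_def)
  ultimately have "((\<lambda>u. sqrt (1 - m * (jacobi_sn u m)\<^sup>2)) has_real_derivative
     - m * jacobi_sn u m * jacobi_cn u m) (at u)"
    using jacobi_dn_pos[of u] by (simp add: field_simps)
  then show ?thesis by (simp add: jacobi_dn_def jacobi_sn_def)
qed

end

lemma jacobi_sn_cn_squared: "(jacobi_sn u m)\<^sup>2 + (jacobi_cn u m)\<^sup>2 = 1"
  by (simp add: jacobi_sn_def jacobi_cn_def)

text \<open>The integrand is even, so the sum of both sides has derivative 0. This makes the
  amplitude odd, as case (5) requires for negative \<open>I 0\<close>.\<close>

lemma ellint_F_minus:
  assumes m: "0 \<le> m" "m < 1"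
  shows "ellint_F (- \<phi>) m = - ellint_F \<phi> m"
proof -
  have "((\<lambda>\<phi>. ellint_F (- \<phi>) m + ellint_F \<phi> m) has_real_derivative 0) (at x)" for x
  proof -
    have "((\<lambda>\<phi>. ellint_F (- \<phi>) m) has_real_derivative 1 / sqrt (1 - m * (sin (- x))\<^sup>2) * (- 1)) (at x)"
      by (rule DERIV_chain2[OF ellint_F_has_derivative[OF m]]) (auto intro!: derivative_eq_intros)
    from DERIV_add[OF this ellint_F_has_derivative[OF m, of x]] show ?thesis by simp
  qed
  from DERIV_isconst_all[OF allI[OF this], of \<phi> 0] show ?thesis by simp
qed

lemma jacobi_am_minus:
  assumes m: "0 \<le> m" "m < 1"
  shows "jacobi_am (- u) m = - jacobi_am u m"
  by (metis ellint_F_minus[OF m] ellint_F_jacobi_am[OF m] jacobi_am_ellint_F[OF m])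

text \<open>The amplitude maps \<open>{0..ellint_K m}\<close> into \<open>{0..pi / 2}\<close>, where
  \<open>sin\<close> is injective and \<open>cos\<close> is nonnegative. The sign of
  \<open>cn\<close> later settles the sign of \<open>I\<close> at time 0.\<close>

lemma jacobi_sn_inv_props:
  assumes m: "0 \<le> m" "m < 1" and y: "0 \<le> y" "y \<le> 1"
  shows "jacobi_sn (jacobi_sn_inv y m) m = y" "jacobi_cn (jacobi_sn_inv y m) m \<ge> 0"
proof -
  note mono = ellint_F_strict_mono[OF m]
  have range: "jacobi_am u m \<in> {0..pi / 2}" if "u \<in> {0..ellint_K m}" for u
    using that strict_mono_less_eq[OF mono, of 0 "jacobi_am u m"]
      strict_mono_less_eq[OF mono, of "jacobi_am u m" "pi / 2"]
    by (simp add: ellint_F_jacobi_am[OF m] ellint_K_def)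
  have inj: "inj_on (\<lambda>u. jacobi_sn u m) {0..ellint_K m}"
  proof (rule inj_onI)
    fix u v assume uv: "u \<in> {0..ellint_K m}" "v \<in> {0..ellint_K m}" "jacobi_sn u m = jacobi_sn v m"
    then have "jacobi_am u m = jacobi_am v m"
      using range[OF uv(1)] range[OF uv(2)] sin_inj_pi[of "jacobi_am u m" "jacobi_am v m"]
      by (auto simp: jacobi_sn_def)
    then show "u = v" by (metis ellint_F_jacobi_am[OF m])
  qed
  have "y \<in> (\<lambda>u. jacobi_sn u m) ` {0..ellint_K m}"
  proof (rule image_eqI)
    show "y = jacobi_sn (ellint_F (arcsin y) m) m"
      using y by (simp add: jacobi_sn_def jacobi_am_ellint_F[OF m])
    show "ellint_F (arcsin y) m \<in> {0..ellint_K m}"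
      using y arcsin_bounded[of y] arcsin_le_arcsin[of 0 y]
        strict_mono_less_eq[OF mono, of 0 "arcsin y"]
        strict_mono_less_eq[OF mono, of "arcsin y" "pi / 2"]
      by (simp add: ellint_K_def)
  qed
  from f_the_inv_into_f[OF inj this] range[OF the_inv_into_into[OF inj this subset_refl]]
  show "jacobi_sn (jacobi_sn_inv y m) m = y" "jacobi_cn (jacobi_sn_inv y m) m \<ge> 0"
    unfolding jacobi_sn_inv_def jacobi_cn_def by (simp_all add: cos_ge_zero)
qed

subsection \<open>Hyperbolic solutions\<close>

lemma tanh_artanh_real:
  fixes x :: real
  assumes "\<bar>x\<bar> < 1"
  shows "tanh (artanh x) = x"
proof -
  have pos: "1 + x > 0" "1 - x > 0" using assms by auto
  have "exp (- 2 * artanh x) = exp (ln ((1 - x) / (1 + x)))"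
    using pos by (simp add: artanh_def ln_div)
  also have "\<dots> = (1 - x) / (1 + x)"
    using pos by (simp del: exp_ln_iff add: exp_ln)
  finally have "tanh (artanh x) = (1 - (1 - x) / (1 + x)) / (1 + (1 - x) / (1 + x))"
    unfolding tanh_real_altdef by (simp only:)
  also have "\<dots> = (2 * x / (1 + x)) / (2 / (1 + x))"
    using pos by (simp add: field_simps)
  also have "\<dots> = x" using pos by simp
  finally show ?thesis .
qed

lemma cosh_artanh_real:
  fixes x :: real
  assumes "\<bar>x\<bar> < 1"
  shows "cosh (artanh x) = 1 / sqrt (1 - x\<^sup>2)"
proof -
  have pos: "1 - x\<^sup>2 > 0" using assms by (simp add: abs_square_less_1)
  have "sinh (artanh x) = x * cosh (artanh x)"
    using tanh_artanh_real[OF assms] cosh_real_pos[of "artanh x"] by (simp add: tanh_def field_simps)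
  then have "(cosh (artanh x))\<^sup>2 * (1 - x\<^sup>2) = 1"
    using cosh_square_eq[of "artanh x"] by (simp add: algebra_simps power_mult_distrib)
  then have "(cosh (artanh x))\<^sup>2 = (1 / sqrt (1 - x\<^sup>2))\<^sup>2"
    using pos by (simp add: field_simps)
  then show ?thesis
    using pos by (simp add: power2_eq_iff_nonneg)
qed

text \<open>For \<open>e = 1\<close> and \<open>e = - 1\<close> the plane \<open>R = e * D\<close>
  is invariant, and on it \<open>D' = k * I * D\<close> and \<open>I' = - 2 * k * D\<^sup>2\<close>.
  On the sphere the latter is the Riccati equation
  \<open>I' = - k * (\<rho>\<^sup>2 - I\<^sup>2)\<close>, which leads to
  \<open>tanh\<close>.\<close>

lemma hyperbolic_solves_system:
  assumes e: "e\<^sup>2 = 1" and \<sigma>: "\<sigma>\<^sup>2 = 1" and k: "k = 2 * (p1 - e * p3)"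
  shows "solves_system p1 p3 J (\<lambda>t. \<sigma> * (\<rho> / (sqrt 2 * cosh (\<tau>0 - k * \<rho> * t))))
     (\<lambda>t. e * (\<sigma> * (\<rho> / (sqrt 2 * cosh (\<tau>0 - k * \<rho> * t))))) (\<lambda>t. \<rho> * tanh (\<tau>0 - k * \<rho> * t))"
proof -
  define x where "x = (\<lambda>t. \<tau>0 - k * \<rho> * t)"
  define D where "D = (\<lambda>t. \<sigma> * (\<rho> / (sqrt 2 * cosh (x t))))"
  define I where "I = (\<lambda>t. \<rho> * tanh (x t))"
  have "solves_system p1 p3 J D (\<lambda>t. e * D t) I"
    unfolding solves_system_def
  proof (intro ballI conjI)
    fix t
    have c: "cosh (x t) \<noteq> 0" using cosh_real_pos[of "x t"] by linarith
    have x: "(x has_real_derivative - k * \<rho>) (at t within J)"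
      unfolding x_def by (auto intro!: derivative_eq_intros)
    have D': "(D has_real_derivative k * I t * D t) (at t within J)"
      unfolding D_def I_def using c
      by (auto intro!: derivative_eq_intros x simp: tanh_def field_simps power2_eq_square)
    \<comment> \<open>The sphere equation \<open>2 * D\<^sup>2 + I\<^sup>2 = \<rho>\<^sup>2\<close>
      along the candidate; it turns the derivative of \<open>tanh\<close> into
      \<open>D\<^sup>2\<close>.\<close>
    have sq: "(D t)\<^sup>2 = \<rho>\<^sup>2 * (1 - (tanh (x t))\<^sup>2) / 2"
    proof -
      have "sinh (x t) = tanh (x t) * cosh (x t)" using c by (simp add: tanh_def)
      then have "(cosh (x t))\<^sup>2 * (1 - (tanh (x t))\<^sup>2) = 1"
        using cosh_square_eq[of "x t"] by algebra
      moreover have "2 * (D t)\<^sup>2 * (cosh (x t))\<^sup>2 = \<rho>\<^sup>2"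
        using \<sigma> c by (simp add: D_def power_mult_distrib power_divide)
      ultimately have "2 * (D t)\<^sup>2 = \<rho>\<^sup>2 * (1 - (tanh (x t))\<^sup>2)" by algebra
      then show ?thesis by simp
    qed
    have "(I has_real_derivative \<rho> * ((1 - (tanh (x t))\<^sup>2) * (- k * \<rho>))) (at t within J)"
      unfolding I_def using c by (auto intro!: derivative_eq_intros x)
    moreover have "\<rho> * ((1 - (tanh (x t))\<^sup>2) * (- k * \<rho>)) = - 2 * k * (D t)\<^sup>2"
      unfolding sq by (simp add: power2_eq_square algebra_simps)
    moreover have "- 2 * k * (D t)\<^sup>2 = - 2 * p1 * ((D t)\<^sup>2 + (e * D t)\<^sup>2) + 4 * p3 * D t * (e * D t)"
      using e unfolding k by algebra
    ultimately have I': "(I has_real_derivative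
        - 2 * p1 * ((D t)\<^sup>2 + (e * D t)\<^sup>2) + 4 * p3 * D t * (e * D t)) (at t within J)"
      by (simp only:)
    have "k * I t * D t = 2 * I t * (p1 * D t - p3 * (e * D t))"
      unfolding k by algebra
    with D' show "(D has_real_derivative 2 * I t * (p1 * D t - p3 * (e * D t))) (at t within J)"
      by (simp only:)
    have "e * (k * I t * D t) = 2 * I t * (p1 * (e * D t) - p3 * D t)"
      using e unfolding k by algebra
    with DERIV_cmult[OF D', of e]
    show "((\<lambda>t. e * D t) has_real_derivative 2 * I t * (p1 * (e * D t) - p3 * D t)) (at t within J)"
      by (simp only:)
    show "(I has_real_derivative
        - 2 * p1 * ((D t)\<^sup>2 + (e * D t)\<^sup>2) + 4 * p3 * D t * (e * D t)) (at t within J)"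
      by (rule I')
  qed
  then show ?thesis unfolding D_def I_def x_def .
qed

text \<open>Case (2) is \<open>e = 1\<close> and case (3) is \<open>e = - 1\<close>. The phase is
  determined by the data at time 0, and uniqueness does the rest.\<close>

lemma hyperbolic_solution:
  assumes sol: "solves_system p1 p3 J D R I" and J: "is_interval J" "0 \<in> J"
    and e: "e\<^sup>2 = 1" "R 0 = e * D 0" and "D 0 \<noteq> 0" and "\<rho> > 0"
    and sphere: "(D 0)\<^sup>2 + (R 0)\<^sup>2 + (I 0)\<^sup>2 = \<rho>\<^sup>2"
    and k: "k = 2 * (p1 - e * p3)"
  shows "artanh (I 0 / \<rho>) = sgn (I 0) * arcosh (\<rho> / (sqrt 2 * \<bar>D 0\<bar>))"
    and "\<tau> \<in> J \<Longrightarrow> D \<tau> = sgn (D 0) * (\<rho> / (sqrt 2 * cosh (artanh (I 0 / \<rho>) - k * \<rho> * \<tau>))) \<and>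
      R \<tau> = e * D \<tau> \<and> I \<tau> = \<rho> * tanh (artanh (I 0 / \<rho>) - k * \<rho> * \<tau>)"
proof -
  define \<tau>0 where "\<tau>0 = artanh (I 0 / \<rho>)"
  have sq: "2 * (D 0)\<^sup>2 = \<rho>\<^sup>2 - (I 0)\<^sup>2"
    using sphere e by (simp add: power_mult_distrib)
  have "(D 0)\<^sup>2 > 0" using \<open>D 0 \<noteq> 0\<close> by simp
  then have "(I 0)\<^sup>2 < \<rho>\<^sup>2" using sq by linarith
  then have "\<bar>I 0\<bar> < \<rho>" using \<open>\<rho> > 0\<close> power2_less_imp_less[of "\<bar>I 0\<bar>" \<rho>] by simp
  then have lt: "\<bar>I 0 / \<rho>\<bar> < 1" using \<open>\<rho> > 0\<close> by (simp add: abs_divide)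
  have tanh: "tanh \<tau>0 = I 0 / \<rho>"
    unfolding \<tau>0_def by (rule tanh_artanh_real[OF lt])
  \<comment> \<open>The sphere equation at time 0 supplies \<open>cosh \<tau>0\<close> from
    \<open>tanh \<tau>0\<close>; this is the source of the second form of the phase.\<close>
  have "1 - (I 0 / \<rho>)\<^sup>2 = (sqrt 2 * \<bar>D 0\<bar> / \<rho>)\<^sup>2"
    using sq \<open>\<rho> > 0\<close> by (simp add: field_simps power_mult_distrib power_divide)
  then have cosh: "cosh \<tau>0 = \<rho> / (sqrt 2 * \<bar>D 0\<bar>)"
    unfolding \<tau>0_def cosh_artanh_real[OF lt] using \<open>\<rho> > 0\<close> by simp
  \<comment> \<open>\<open>arcosh\<close> recovers only \<open>\<bar>\<tau>0\<bar>\<close>, so the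
    sign has to come from \<open>tanh \<tau>0\<close>.\<close>
  have "sgn (I 0) = sgn \<tau>0"
    using tanh \<open>\<rho> > 0\<close> tanh_real_pos_iff[of \<tau>0] tanh_real_neg_iff[of \<tau>0]
    by (auto simp: sgn_if zero_less_divide_iff split: if_splits)
  moreover have "arcosh (cosh \<tau>0) = \<bar>\<tau>0\<bar>"
    using arcosh_cosh_real[of "\<bar>\<tau>0\<bar>"] by (simp add: cosh_real_abs)
  ultimately show "artanh (I 0 / \<rho>) = sgn (I 0) * arcosh (\<rho> / (sqrt 2 * \<bar>D 0\<bar>))"
    unfolding cosh[symmetric] \<tau>0_def[symmetric] by (simp add: sgn_mult_abs)
  assume \<tau>: "\<tau> \<in> J"
  have \<sigma>: "(sgn (D 0))\<^sup>2 = 1" using \<open>D 0 \<noteq> 0\<close> by (simp add: sgn_if)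
  have init: "sgn (D 0) * (\<rho> / (sqrt 2 * cosh (\<tau>0 - k * \<rho> * 0))) = D 0"
    using \<open>\<rho> > 0\<close> \<open>D 0 \<noteq> 0\<close> by (simp add: cosh sgn_mult_abs)
  from solves_system_unique[OF sol hyperbolic_solves_system[OF e(1) \<sigma> k, of J \<rho> \<tau>0] J \<tau>]
  show "D \<tau> = sgn (D 0) * (\<rho> / (sqrt 2 * cosh (artanh (I 0 / \<rho>) - k * \<rho> * \<tau>))) \<and>
      R \<tau> = e * D \<tau> \<and> I \<tau> = \<rho> * tanh (artanh (I 0 / \<rho>) - k * \<rho> * \<tau>)"
    using \<open>\<rho> > 0\<close> tanh e(2) unfolding init \<tau>0_def[symmetric] by simp
qed

subsection \<open>Elliptic solutions\<close>

text \<open>For \<open>p1 = 1/3 * p3\<close> the growth rates of \<open>D + R\<close> and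
  \<open>D - R\<close> are \<open>- 4/3 * p3 * I\<close> and \<open>8/3 * p3 * I\<close>; their
  quotient is the exponent \<open>-1/2\<close>. This leaves two equations, for \<open>w\<close> and
  \<open>I\<close>. The constants \<open>s\<close> and \<open>d\<close> are the values of
  \<open>D + R\<close> and \<open>D - R\<close> where \<open>w = 1\<close>.\<close>

lemma solves_system_of_ratio:
  assumes w: "\<And>t. w t > 0"
    and w': "\<And>t. (w has_real_derivative 8/3 * p3 * I t * w t) (at t)"
    and I': "\<And>t. (I has_real_derivative 2/3 * p3 * (s\<^sup>2 / w t - 2 * d\<^sup>2 * (w t)\<^sup>2)) (at t)"
  shows "solves_system (1/3 * p3) p3 J (\<lambda>t. s / 2 * w t powr (-1/2) + d / 2 * w t)
    (\<lambda>t. s / 2 * w t powr (-1/2) - d / 2 * w t) I"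
  unfolding solves_system_def
proof (intro ballI conjI)
  fix t
  define v where "v = w t powr (-1/2)"
  have v2: "v\<^sup>2 = 1 / w t"
    using w[of t] by (simp add: v_def power2_eq_square powr_add[symmetric] powr_minus_divide)
  have "((\<lambda>t. w t powr (-1/2)) has_real_derivative
      (-1/2) * w t powr (-1/2 - 1) * (8/3 * p3 * I t * w t)) (at t)"
    by (rule DERIV_chain2[where f = "\<lambda>z. z powr (-1/2)", OF has_real_derivative_powr[OF w] w'])
  moreover have "w t powr (-1/2 - 1) * w t = v"
    using w[of t] unfolding v_def by (subst powr_diff) simp
  then have "(-1/2) * w t powr (-1/2 - 1) * (8/3 * p3 * I t * w t) = - 4/3 * p3 * I t * v"
    by (simp add: field_simps)
  ultimately have v': "((\<lambda>t. w t powr (-1/2)) has_real_derivative - 4/3 * p3 * I t * v) (at t)"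
    by (simp only:)
  have "((\<lambda>t. s / 2 * w t powr (-1/2) + d / 2 * w t) has_real_derivative
      s / 2 * (- 4/3 * p3 * I t * v) + d / 2 * (8/3 * p3 * I t * w t)) (at t)"
    by (intro DERIV_add DERIV_cmult v' w')
  moreover have "s / 2 * (- 4/3 * p3 * I t * v) + d / 2 * (8/3 * p3 * I t * w t) =
      2 * I t * (1/3 * p3 * (s / 2 * v + d / 2 * w t) - p3 * (s / 2 * v - d / 2 * w t))"
    by (simp add: field_simps)
  ultimately show "((\<lambda>t. s / 2 * w t powr (-1/2) + d / 2 * w t) has_real_derivative
      2 * I t * (1/3 * p3 * (s / 2 * w t powr (-1/2) + d / 2 * w t) -
       p3 * (s / 2 * w t powr (-1/2) - d / 2 * w t))) (at t within J)"
    unfolding v_def[symmetric] by (simp only: has_field_derivative_at_within)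
  have "((\<lambda>t. s / 2 * w t powr (-1/2) - d / 2 * w t) has_real_derivative
      s / 2 * (- 4/3 * p3 * I t * v) - d / 2 * (8/3 * p3 * I t * w t)) (at t)"
    by (intro DERIV_diff DERIV_cmult v' w')
  moreover have "s / 2 * (- 4/3 * p3 * I t * v) - d / 2 * (8/3 * p3 * I t * w t) =
      2 * I t * (1/3 * p3 * (s / 2 * v - d / 2 * w t) - p3 * (s / 2 * v + d / 2 * w t))"
    by (simp add: field_simps)
  ultimately show "((\<lambda>t. s / 2 * w t powr (-1/2) - d / 2 * w t) has_real_derivative
      2 * I t * (1/3 * p3 * (s / 2 * w t powr (-1/2) - d / 2 * w t) -
       p3 * (s / 2 * w t powr (-1/2) + d / 2 * w t))) (at t within J)"
    unfolding v_def[symmetric] by (simp only: has_field_derivative_at_within)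
  have "2/3 * p3 * (s\<^sup>2 / w t - 2 * d\<^sup>2 * (w t)\<^sup>2) = 2/3 * p3 * (s\<^sup>2 * v\<^sup>2 - 2 * d\<^sup>2 * (w t)\<^sup>2)"
    by (simp add: v2)
  also have "\<dots> = - 2 * (1/3 * p3) * ((s / 2 * v + d / 2 * w t)\<^sup>2 + (s / 2 * v - d / 2 * w t)\<^sup>2) +
      4 * p3 * (s / 2 * v + d / 2 * w t) * (s / 2 * v - d / 2 * w t)"
    by (simp add: power2_eq_square field_simps)
  finally show "(I has_real_derivative
      - 2 * (1/3 * p3) * ((s / 2 * w t powr (-1/2) + d / 2 * w t)\<^sup>2 + (s / 2 * w t powr (-1/2) - d / 2 * w t)\<^sup>2) +
      4 * p3 * (s / 2 * w t powr (-1/2) + d / 2 * w t) * (s / 2 * w t powr (-1/2) - d / 2 * w t)) (at t within J)"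
    using has_field_derivative_at_within[OF I', of t J] unfolding v_def by (simp only:)
qed

text \<open>With \<open>x = q\<close>, \<open>r = q'\<close> and \<open>r2 = q''\<close>, the last
  factor on the left is the numerator of the derivative of \<open>x * r / \<Delta>\<close>. The
  right side is, up to a constant factor, \<open>\<Delta>\<^sup>2\<close> times the derivative of
  \<open>I\<close> that \<open>solves_system_of_ratio\<close> requires.\<close>

lemma elliptic_identity:
  fixes x r r2 m c \<beta> \<gamma> :: real
  assumes m: "m * (\<gamma> * (2 * \<beta> + \<gamma>)) = (\<gamma> - \<beta>) * (\<beta> + \<gamma>)"
    and r: "r\<^sup>2 = (1 - x\<^sup>2) * (1 - m * x\<^sup>2)" and r2: "r2 = - (1 + m) * x + 2 * m * x ^ 3"
    and \<Delta>: "\<Delta> = \<gamma> - (\<gamma> - \<beta>) * x\<^sup>2"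
  shows "\<gamma> * (2 * \<beta> + \<gamma>) * (\<gamma> - \<beta>) * ((r\<^sup>2 + x * r2) * \<Delta> + 2 * (\<gamma> - \<beta>) * x\<^sup>2 * r\<^sup>2) =
    (\<beta> + \<gamma>) * \<Delta> ^ 3 - 2 * \<beta>\<^sup>2 * \<gamma>\<^sup>2"
proof -
  \<comment> \<open>Multiplication by \<open>n\<close>, the denominator of \<open>m\<close>, makes
    everything polynomial in \<open>\<beta>\<close>, \<open>\<gamma>\<close> and
    \<open>x\<close>.\<close>
  define n where "n = \<gamma> * (2 * \<beta> + \<gamma>)"
  have 1: "n * r\<^sup>2 = (1 - x\<^sup>2) * (n - (\<gamma> - \<beta>) * (\<beta> + \<gamma>) * x\<^sup>2)"
    unfolding r using m unfolding n_def[symmetric] by algebra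
  have 2: "n * (x * r2) = - (n + (\<gamma> - \<beta>) * (\<beta> + \<gamma>)) * x\<^sup>2 + 2 * (\<gamma> - \<beta>) * (\<beta> + \<gamma>) * x ^ 4"
    unfolding r2 using m unfolding n_def[symmetric] by algebra
  have "n * (\<gamma> - \<beta>) * ((r\<^sup>2 + x * r2) * \<Delta> + 2 * (\<gamma> - \<beta>) * x\<^sup>2 * r\<^sup>2) =
    (\<gamma> - \<beta>) * ((n * r\<^sup>2 + n * (x * r2)) * \<Delta> + 2 * (\<gamma> - \<beta>) * x\<^sup>2 * (n * r\<^sup>2))"
    by algebra
  also have "\<dots> = (\<beta> + \<gamma>) * \<Delta> ^ 3 - 2 * \<beta>\<^sup>2 * \<gamma>\<^sup>2"
    unfolding 1 2 unfolding n_def \<Delta> by algebra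
  finally show ?thesis unfolding n_def .
qed


text \<open>\<open>q\<close> stands for \<open>sn\<close> or \<open>cd\<close>. The cubic has no
  quadratic term, so its roots sum to 0, whence \<open>\<alpha>\<close>; the value of
  \<open>s\<^sup>2\<close> is \<open>2 * cm\<close> with \<open>cm\<close> expressed by the product
  of the roots. The \<open>I\<close> component is built so that the equation for \<open>w\<close>
  holds by differentiation; the equation for \<open>I\<close> comes from
  \<open>elliptic_identity\<close>.\<close>

lemma elliptic_solves_system:
  fixes q r :: "real \<Rightarrow> real" and p3 \<tau>0 :: real
  assumes c: "c > 0" and \<beta>: "0 < \<beta>" "\<beta> \<le> \<gamma>" and \<alpha>: "\<alpha> = - (\<beta> + \<gamma>)"
    and m: "m = (\<gamma> - \<beta>) * (- \<alpha>) / (\<gamma> * (\<beta> - \<alpha>))"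
    and s: "s\<^sup>2 = 2 * c * \<beta> * \<gamma> * (\<beta> + \<gamma>)" and d: "d\<^sup>2 = 2 * c"
    and q: "\<And>x. (q has_real_derivative r x) (at x)"
    and r: "\<And>x. (r has_real_derivative - (1 + m) * q x + 2 * m * q x ^ 3) (at x)"
    and r_sq: "\<And>x. (r x)\<^sup>2 = (1 - (q x)\<^sup>2) * (1 - m * (q x)\<^sup>2)"
    and q_le: "\<And>x. (q x)\<^sup>2 \<le> 1"
  defines "k \<equiv> sqrt (c * \<gamma> * (\<beta> - \<alpha>))"
  defines "u \<equiv> \<lambda>t. 4/3 * p3 * k * t + \<tau>0"
  defines "w \<equiv> \<lambda>t. \<beta> * \<gamma> / (\<gamma> - (\<gamma> - \<beta>) * (q (u t))\<^sup>2)"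
  shows "solves_system (1/3 * p3) p3 J (\<lambda>t. s / 2 * w t powr (-1/2) + d / 2 * w t)
    (\<lambda>t. s / 2 * w t powr (-1/2) - d / 2 * w t)
    (\<lambda>t. k * (\<gamma> - \<beta>) * (q (u t) * r (u t) / (\<gamma> - (\<gamma> - \<beta>) * (q (u t))\<^sup>2)))"
proof (rule solves_system_of_ratio)
  define \<Delta> where "\<Delta> t = \<gamma> - (\<gamma> - \<beta>) * (q (u t))\<^sup>2" for t
  have \<gamma>: "\<gamma> > 0" using \<beta> by simp
  have \<Delta>: "\<Delta> t > 0" for t
  proof -
    have "(\<gamma> - \<beta>) * (q (u t))\<^sup>2 \<le> (\<gamma> - \<beta>) * 1"
      using \<beta> q_le[of "u t"] by (intro mult_left_mono) auto
    then show ?thesis using \<beta> by (simp add: \<Delta>_def)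
  qed
  have pos: "2 * \<beta> + \<gamma> > 0" using \<beta> \<gamma> by simp
  have k: "k\<^sup>2 = c * (\<gamma> * (2 * \<beta> + \<gamma>))"
    using c \<gamma> pos by (simp add: k_def \<alpha>)
  have m': "m * (\<gamma> * (2 * \<beta> + \<gamma>)) = (\<gamma> - \<beta>) * (\<beta> + \<gamma>)"
  proof -
    have "\<beta> - \<alpha> = 2 * \<beta> + \<gamma>" "- \<alpha> = \<beta> + \<gamma>" by (simp_all add: \<alpha>)
    then show ?thesis unfolding m using \<gamma> pos by (simp only:) simp
  qed
  have u: "(u has_real_derivative 4/3 * p3 * k) (at t)" for t
    unfolding u_def by (auto intro!: derivative_eq_intros)
  have qu: "((\<lambda>t. q (u t)) has_real_derivative r (u t) * (4/3 * p3 * k)) (at t)" for t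
    by (rule DERIV_chain2[OF q u])
  have ru: "((\<lambda>t. r (u t)) has_real_derivative
      (- (1 + m) * q (u t) + 2 * m * q (u t) ^ 3) * (4/3 * p3 * k)) (at t)" for t
    by (rule DERIV_chain2[OF r u])
  have \<Delta>': "(\<Delta> has_real_derivative - 2 * (\<gamma> - \<beta>) * q (u t) * (r (u t) * (4/3 * p3 * k))) (at t)" for t
    unfolding \<Delta>_def by (auto intro!: derivative_eq_intros qu simp: algebra_simps)
  fix t
  have nz: "\<Delta> t \<noteq> 0" using \<Delta>[of t] by simp
  show "w t > 0"
    using \<Delta>[of t] \<beta> \<gamma> by (simp add: w_def \<Delta>_def)
  have "((\<lambda>t. \<beta> * \<gamma> / \<Delta> t) has_real_derivative
      8/3 * p3 * (k * (\<gamma> - \<beta>) * (q (u t) * r (u t) / \<Delta> t)) * (\<beta> * \<gamma> / \<Delta> t)) (at t)"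
    using nz by (auto intro!: derivative_eq_intros \<Delta>' simp: field_simps power2_eq_square)
  then show "(w has_real_derivative 8/3 * p3 *
      (k * (\<gamma> - \<beta>) * (q (u t) * r (u t) / (\<gamma> - (\<gamma> - \<beta>) * (q (u t))\<^sup>2))) * w t) (at t)"
    unfolding w_def \<Delta>_def .
  define x y z where "x = q (u t)" and "y = r (u t)" and "z = - (1 + m) * x + 2 * m * x ^ 3"
  note xyz = x_def[symmetric] y_def[symmetric] z_def[symmetric]
  have "((\<lambda>t. k * (\<gamma> - \<beta>) * (q (u t) * r (u t) / \<Delta> t)) has_real_derivative
      4/3 * p3 * k\<^sup>2 * (\<gamma> - \<beta>) * ((y\<^sup>2 + x * z) * \<Delta> t + 2 * (\<gamma> - \<beta>) * x\<^sup>2 * y\<^sup>2) / (\<Delta> t)\<^sup>2) (at t)"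
    using nz by (auto intro!: derivative_eq_intros qu ru \<Delta>' simp only: xyz)
      (simp add: field_simps power2_eq_square)
  moreover have "4/3 * p3 * k\<^sup>2 * (\<gamma> - \<beta>) * ((y\<^sup>2 + x * z) * \<Delta> t + 2 * (\<gamma> - \<beta>) * x\<^sup>2 * y\<^sup>2)
      = 4/3 * p3 * c * ((\<beta> + \<gamma>) * \<Delta> t ^ 3 - 2 * \<beta>\<^sup>2 * \<gamma>\<^sup>2)"
  proof -
    have "y\<^sup>2 = (1 - x\<^sup>2) * (1 - m * x\<^sup>2)" unfolding x_def y_def by (rule r_sq)
    moreover have "\<Delta> t = \<gamma> - (\<gamma> - \<beta>) * x\<^sup>2" unfolding x_def by (rule \<Delta>_def)
    ultimately show ?thesis
      using elliptic_identity[OF m' _ z_def] unfolding k by (simp add: mult.assoc)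
  qed
  moreover have "4/3 * p3 * c * ((\<beta> + \<gamma>) * \<Delta> t ^ 3 - 2 * \<beta>\<^sup>2 * \<gamma>\<^sup>2) / (\<Delta> t)\<^sup>2 =
      2/3 * p3 * (s\<^sup>2 / (\<beta> * \<gamma> / \<Delta> t) - 2 * d\<^sup>2 * (\<beta> * \<gamma> / \<Delta> t)\<^sup>2)"
    unfolding s d using nz \<beta> \<gamma> by (simp add: field_simps power2_eq_square power3_eq_cube)
  ultimately have "((\<lambda>t. k * (\<gamma> - \<beta>) * (q (u t) * r (u t) / \<Delta> t)) has_real_derivative
      2/3 * p3 * (s\<^sup>2 / (\<beta> * \<gamma> / \<Delta> t) - 2 * d\<^sup>2 * (\<beta> * \<gamma> / \<Delta> t)\<^sup>2)) (at t)"
    by (simp only:)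
  then show "((\<lambda>t. k * (\<gamma> - \<beta>) * (q (u t) * r (u t) / (\<gamma> - (\<gamma> - \<beta>) * (q (u t))\<^sup>2)))
      has_real_derivative 2/3 * p3 * (s\<^sup>2 / w t - 2 * d\<^sup>2 * (w t)\<^sup>2)) (at t)"
    unfolding w_def \<Delta>_def .
qed

text \<open>Uniqueness reduces the claim to time 0: \<open>init_q\<close> gives
  \<open>w 0 = 1\<close>, which starts \<open>D\<close> and \<open>R\<close> correctly, and
  \<open>init_I\<close> does the same for \<open>I\<close>. \<open>k\<close>, \<open>u\<close> and
  \<open>w\<close> enter through equations, so that each case can insert its own formulas by
  \<open>refl\<close>.\<close>

lemma elliptic_solution:
  fixes q r D R I :: "real \<Rightarrow> real"
  assumes sol: "solves_system (1/3 * p3) p3 J D R I" and J: "is_interval J" "0 \<in> J"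
    and c: "c > 0" and \<beta>: "0 < \<beta>" "\<beta> \<le> \<gamma>" and \<alpha>: "\<alpha> = - (\<beta> + \<gamma>)"
    and m: "m = (\<gamma> - \<beta>) * (- \<alpha>) / (\<gamma> * (\<beta> - \<alpha>))"
    and s: "(D 0 + R 0)\<^sup>2 = 2 * c * \<beta> * \<gamma> * (\<beta> + \<gamma>)" and d: "(D 0 - R 0)\<^sup>2 = 2 * c"
    and q: "\<And>x. (q has_real_derivative r x) (at x)"
    and r: "\<And>x. (r has_real_derivative - (1 + m) * q x + 2 * m * q x ^ 3) (at x)"
    and r_sq: "\<And>x. (r x)\<^sup>2 = (1 - (q x)\<^sup>2) * (1 - m * (q x)\<^sup>2)"
    and q_le: "\<And>x. (q x)\<^sup>2 \<le> 1"
    and k: "k = sqrt (c * \<gamma> * (\<beta> - \<alpha>))"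
    and u: "u = (\<lambda>t. 4/3 * p3 * k * t + \<tau>0)"
    and w: "w = (\<lambda>t. \<beta> * \<gamma> / (\<gamma> - (\<gamma> - \<beta>) * (q (u t))\<^sup>2))"
    and init_q: "\<gamma> - (\<gamma> - \<beta>) * (q \<tau>0)\<^sup>2 = \<beta> * \<gamma>"
    and init_I: "I 0 = k * (\<gamma> - \<beta>) * (q \<tau>0 * r \<tau>0 / (\<beta> * \<gamma>))"
    and \<tau>: "\<tau> \<in> J"
  shows "D \<tau> = (D 0 + R 0) / 2 * w \<tau> powr (-1/2) + (D 0 - R 0) / 2 * w \<tau> \<and>
    R \<tau> = (D 0 + R 0) / 2 * w \<tau> powr (-1/2) - (D 0 - R 0) / 2 * w \<tau> \<and>
    I \<tau> = k * (\<gamma> - \<beta>) * (q (u \<tau>) * r (u \<tau>) / (\<gamma> - (\<gamma> - \<beta>) * (q (u \<tau>))\<^sup>2))"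
proof -
  have u0: "u 0 = \<tau>0" by (simp add: u)
  have w0: "w 0 = 1" unfolding w u0 init_q using \<beta> by simp
  have "solves_system (1/3 * p3) p3 J
    (\<lambda>t. (D 0 + R 0) / 2 * w t powr (-1/2) + (D 0 - R 0) / 2 * w t)
    (\<lambda>t. (D 0 + R 0) / 2 * w t powr (-1/2) - (D 0 - R 0) / 2 * w t)
    (\<lambda>t. k * (\<gamma> - \<beta>) * (q (u t) * r (u t) / (\<gamma> - (\<gamma> - \<beta>) * (q (u t))\<^sup>2)))"
    unfolding w u k by (rule elliptic_solves_system[OF c \<beta> \<alpha> m s d q r r_sq q_le])
  then show ?thesis
  proof (rule solves_system_unique[OF sol _ J \<tau>])
    show "k * (\<gamma> - \<beta>) * (q (u 0) * r (u 0) / (\<gamma> - (\<gamma> - \<beta>) * (q (u 0))\<^sup>2)) = I 0"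
      unfolding u0 init_q init_I ..
  qed (simp_all add: w0 field_simps)
qed

section \<open>Differential equations shared by sn and cd\<close>

context
  fixes m :: real
  assumes m: "0 \<le> m" "m < 1"
begin

lemma jacobi_sn_le: "(jacobi_sn u m)\<^sup>2 \<le> 1"
  by (simp add: jacobi_sn_def abs_square_le_1)

lemma jacobi_sn_deriv_sq:
  "(jacobi_cn u m * jacobi_dn u m)\<^sup>2 = (1 - (jacobi_sn u m)\<^sup>2) * (1 - m * (jacobi_sn u m)\<^sup>2)"
  using jacobi_sn_cn_squared[of u m] jacobi_dn_squared[OF m, of u] by algebra

lemma jacobi_sn_has_second_derivative:
  "((\<lambda>u. jacobi_cn u m * jacobi_dn u m) has_real_derivative
     - (1 + m) * jacobi_sn u m + 2 * m * jacobi_sn u m ^ 3) (at u)"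
proof -
  have "((\<lambda>u. jacobi_cn u m * jacobi_dn u m) has_real_derivative
     (- jacobi_sn u m * jacobi_dn u m) * jacobi_dn u m +
     (- m * jacobi_sn u m * jacobi_cn u m) * jacobi_cn u m) (at u)"
    by (rule DERIV_mult[OF jacobi_cn_has_derivative[OF m] jacobi_dn_has_derivative[OF m]])
  moreover have "(- jacobi_sn u m * jacobi_dn u m) * jacobi_dn u m +
     (- m * jacobi_sn u m * jacobi_cn u m) * jacobi_cn u m =
     - (1 + m) * jacobi_sn u m + 2 * m * jacobi_sn u m ^ 3"
    using jacobi_sn_cn_squared[of u m] jacobi_dn_squared[OF m, of u] by algebra
  ultimately show ?thesis by (simp only:)
qed

text \<open>The right side is the function \<open>r\<close> that belongs to \<open>q = cd\<close>.
  The quotient rule simplifies to it because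
  \<open>dn\<^sup>2 - m * cn\<^sup>2 = 1 - m\<close>.\<close>

lemma jacobi_cd_has_derivative:
  "((\<lambda>u. jacobi_cd u m) has_real_derivative - (1 - m) * (jacobi_sd u m * jacobi_nd u m)) (at u)"
proof -
  define s c d where "s = jacobi_sn u m" and "c = jacobi_cn u m" and "d = jacobi_dn u m"
  have d: "d \<noteq> 0" using jacobi_dn_pos[OF m, of u] by (simp add: d_def)
  have "((\<lambda>u. jacobi_cn u m / jacobi_dn u m) has_real_derivative
     (- s * d * d - c * (- m * s * c)) / (d * d)) (at u)"
    unfolding s_def c_def d_def
    by (rule DERIV_divide[OF jacobi_cn_has_derivative[OF m] jacobi_dn_has_derivative[OF m]])
      (use d d_def in simp)
  moreover have "- s * d * d - c * (- m * s * c) = - (1 - m) * s"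
    using jacobi_sn_cn_squared[of u m] jacobi_dn_squared[OF m, of u]
    unfolding s_def[symmetric] c_def[symmetric] d_def[symmetric] by algebra
  moreover have "- (1 - m) * s / (d * d) = - (1 - m) * (jacobi_sd u m * jacobi_nd u m)"
    unfolding s_def d_def jacobi_sd_def jacobi_nd_def by simp
  ultimately show ?thesis unfolding jacobi_cd_def by (simp only:)
qed

lemma jacobi_cd_has_second_derivative:
  "((\<lambda>u. - (1 - m) * (jacobi_sd u m * jacobi_nd u m)) has_real_derivative
     - (1 + m) * jacobi_cd u m + 2 * m * jacobi_cd u m ^ 3) (at u)"
proof -
  define s c d where "s = jacobi_sn u m" and "c = jacobi_cn u m" and "d = jacobi_dn u m"
  have d: "d \<noteq> 0" using jacobi_dn_pos[OF m, of u] by (simp add: d_def)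
  have eqs: "s\<^sup>2 + c\<^sup>2 = 1" "d\<^sup>2 = 1 - m * s\<^sup>2"
    using jacobi_sn_cn_squared[of u m] jacobi_dn_squared[OF m, of u]
    by (simp_all add: s_def c_def d_def)
  have dd: "((\<lambda>u. jacobi_dn u m * jacobi_dn u m) has_real_derivative
     (- m * s * c) * d + (- m * s * c) * d) (at u)"
    unfolding s_def c_def d_def
    by (rule DERIV_mult[OF jacobi_dn_has_derivative[OF m] jacobi_dn_has_derivative[OF m]])
  have "((\<lambda>u. - (1 - m) * (jacobi_sn u m / (jacobi_dn u m * jacobi_dn u m))) has_real_derivative
     - (1 - m) * (((c * d) * (d * d) - s * ((- m * s * c) * d + (- m * s * c) * d)) / (d * d * (d * d)))) (at u)"
    using DERIV_cmult[OF DERIV_divide[OF jacobi_sn_has_derivative[OF m, of u] dd], of "- (1 - m)"] d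
    unfolding s_def[symmetric] c_def[symmetric] d_def[symmetric] by simp
  moreover have "- (1 - m) * (((c * d) * (d * d) - s * ((- m * s * c) * d + (- m * s * c) * d)) / (d * d * (d * d))) =
      - (1 - m) * (c * d\<^sup>2 + 2 * m * s\<^sup>2 * c) / d ^ 3"
    using d by (simp add: field_simps power2_eq_square power3_eq_cube)
  \<comment> \<open>In this form, division by \<open>d ^ 3\<close> leaves exactly \<open>cd\<close>
    and its cube.\<close>
  moreover have "- (1 - m) * (c * d\<^sup>2 + 2 * m * s\<^sup>2 * c) = - (1 + m) * c * d\<^sup>2 + 2 * m * c ^ 3"
    using eqs by algebra
  moreover have "(- (1 + m) * c * d\<^sup>2 + 2 * m * c ^ 3) / d ^ 3 = - (1 + m) * jacobi_cd u m + 2 * m * jacobi_cd u m ^ 3"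
    unfolding jacobi_cd_def c_def[symmetric] d_def[symmetric]
    using d by (simp add: field_simps power2_eq_square power3_eq_cube)
  moreover have "(\<lambda>u. - (1 - m) * (jacobi_sd u m * jacobi_nd u m)) =
      (\<lambda>u. - (1 - m) * (jacobi_sn u m / (jacobi_dn u m * jacobi_dn u m)))"
    unfolding jacobi_sd_def jacobi_nd_def by simp
  ultimately show ?thesis by (simp only:)
qed

text \<open>The two factors of the first order equation for \<open>cd\<close>: their product is the
  square of its derivative, and the first one also bounds \<open>cd\<^sup>2\<close> by 1.\<close>

lemma jacobi_cd_sq:
  "1 - (jacobi_cd u m)\<^sup>2 = (1 - m) * (jacobi_sd u m)\<^sup>2"
  "1 - m * (jacobi_cd u m)\<^sup>2 = (1 - m) * (jacobi_nd u m)\<^sup>2"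
proof -
  have d: "(jacobi_dn u m)\<^sup>2 \<noteq> 0" using jacobi_dn_pos[OF m, of u] by simp
  have 1: "(jacobi_dn u m)\<^sup>2 - (jacobi_cn u m)\<^sup>2 = (1 - m) * (jacobi_sn u m)\<^sup>2"
    and 2: "(jacobi_dn u m)\<^sup>2 - m * (jacobi_cn u m)\<^sup>2 = 1 - m"
    using jacobi_sn_cn_squared[of u m] jacobi_dn_squared[OF m, of u] by (algebra, algebra)
  show "1 - (jacobi_cd u m)\<^sup>2 = (1 - m) * (jacobi_sd u m)\<^sup>2"
    unfolding jacobi_cd_def jacobi_sd_def power_divide times_divide_eq_right 1[symmetric]
    using d by (simp add: diff_divide_distrib)
  show "1 - m * (jacobi_cd u m)\<^sup>2 = (1 - m) * (jacobi_nd u m)\<^sup>2"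
    unfolding jacobi_cd_def jacobi_nd_def power_divide times_divide_eq_right 2[symmetric]
    using d by (simp add: diff_divide_distrib)
qed

lemma jacobi_cd_le: "(jacobi_cd u m)\<^sup>2 \<le> 1"
proof -
  have "0 \<le> (1 - m) * (jacobi_sd u m)\<^sup>2" using m by simp
  then show ?thesis using jacobi_cd_sq(1)[of u] by linarith
qed

lemma jacobi_cd_deriv_sq:
  "(- (1 - m) * (jacobi_sd u m * jacobi_nd u m))\<^sup>2 =
    (1 - (jacobi_cd u m)\<^sup>2) * (1 - m * (jacobi_cd u m)\<^sup>2)"
  unfolding jacobi_cd_sq by algebra

end

section \<open>Range of the parameter and roots of the polynomials\<close>

lemma jacobi_parameter_range:
  fixes \<alpha> \<beta> \<gamma> :: real
  assumes "\<alpha> < 0" "0 < \<beta>" "\<beta> \<le> \<gamma>"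
  shows "0 \<le> (\<gamma> - \<beta>) * (- \<alpha>) / (\<gamma> * (\<beta> - \<alpha>))"
    and "(\<gamma> - \<beta>) * (- \<alpha>) / (\<gamma> * (\<beta> - \<alpha>)) < 1"
proof -
  have pos: "\<gamma> * (\<beta> - \<alpha>) > 0" using assms by simp
  show "0 \<le> (\<gamma> - \<beta>) * (- \<alpha>) / (\<gamma> * (\<beta> - \<alpha>))"
    by (rule divide_nonneg_pos[OF mult_nonneg_nonneg pos]) (use assms in auto)
  \<comment> \<open>\<open>m < 1\<close> because the denominator exceeds the numerator by this
    positive amount.\<close>
  have "\<gamma> * (\<beta> - \<alpha>) - (\<gamma> - \<beta>) * (- \<alpha>) = \<beta> * (\<gamma> - \<alpha>)" by algebra
  moreover have "\<beta> * (\<gamma> - \<alpha>) > 0" using assms by simp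
  ultimately show "(\<gamma> - \<beta>) * (- \<alpha>) / (\<gamma> * (\<beta> - \<alpha>)) < 1"
    using pos by (subst pos_divide_less_eq) linarith+
qed

text \<open>With \<open>c = cp\<close> and \<open>b = cm\<close>: if \<open>I 0 = 0\<close>, then
  \<open>\<rho>\<^sup>2 = cp + cm\<close> and the cubic of case (5) is \<open>1 - w\<close> times
  this quadratic. So 1 is its third root, and the relations between the roots take the shape that
  \<open>elliptic_solution\<close> expects.\<close>

lemma quadratic_roots:
  fixes c b :: real
  assumes c: "c > 0" and b: "b > 0"
    and \<alpha>: "\<alpha> = - 1/2 - sqrt (c * (c + 4 * b)) / (2 * c)"
    and \<beta>: "\<beta> = - 1/2 + sqrt (c * (c + 4 * b)) / (2 * c)"
  shows "\<alpha> = - (\<beta> + 1)" "b = c * \<beta> * (\<beta> + 1)" "\<beta> > 0"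
    "{x. c * x\<^sup>2 + c * x - b = 0} = {\<alpha>, \<beta>}"
proof -
  define s where "s = sqrt (c * (c + 4 * b))"
  have s: "s\<^sup>2 = c * (c + 4 * b)" unfolding s_def using c b by simp
  show 1: "\<alpha> = - (\<beta> + 1)" unfolding \<alpha> \<beta> by simp
  have s\<beta>: "s = c * (2 * \<beta> + 1)" unfolding \<beta> s_def[symmetric] using c by (simp add: field_simps)
  then have "c * b = c * (c * \<beta> * (\<beta> + 1))" using s by algebra
  then show 2: "b = c * \<beta> * (\<beta> + 1)" using c by simp
  have "c\<^sup>2 < s\<^sup>2" unfolding s using c b by (simp add: power2_eq_square algebra_simps)
  moreover have "s \<ge> 0" unfolding s_def using c b by simp
  ultimately have "c < s" by (rule power2_less_imp_less)
  then show "\<beta> > 0" unfolding s\<beta> using c by simp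
  have "c * x\<^sup>2 + c * x - b = c * ((x - \<alpha>) * (x - \<beta>))" for x
    unfolding 1 2 by algebra
  then show "{x. c * x\<^sup>2 + c * x - b = 0} = {\<alpha>, \<beta>}" using c by auto
qed

text \<open>\<open>c + b < a\<close> makes the cubic positive at 1, while it is negative at 0 and
  for large arguments; this separates \<open>\<beta>\<close> from \<open>\<gamma>\<close>. The third
  root follows because there is no quadratic term.\<close>

lemma cubic_roots:
  fixes a b c :: real
  assumes c: "c > 0" and b: "b > 0" and a: "c + b < a"
  obtains \<beta> \<gamma> where "0 < \<beta>" "\<beta> < 1" "1 < \<gamma>" "a = c * (\<beta>\<^sup>2 + \<beta> * \<gamma> + \<gamma>\<^sup>2)"
    "b = c * \<beta> * \<gamma> * (\<beta> + \<gamma>)" "{x. - c * x ^ 3 + a * x - b = 0} = {- (\<beta> + \<gamma>), \<beta>, \<gamma>}"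
proof -
  define f where "f = (\<lambda>x. - c * x ^ 3 + a * x - b)"
  have cont: "isCont f x" for x unfolding f_def by (intro continuous_intros)
  have f0: "f 0 < 0" and f1: "f 1 > 0" using a b by (simp_all add: f_def)
  obtain \<beta> where "0 \<le> \<beta>" "\<beta> \<le> 1" and f\<beta>: "f \<beta> = 0"
    using IVT[of f 0 0 1] f0 f1 cont by auto
  with f0 f1 have \<beta>: "0 < \<beta>" "\<beta> < 1" by (auto simp: less_le)
  \<comment> \<open>Chosen so that \<open>X > 1\<close> and \<open>c * X = c + a\<close>, hence the
    cubic term outweighs \<open>a * X\<close>.\<close>
  define X where "X = 1 + a / c"
  have X: "X > 1" "c * X > a" using a b c by (simp_all add: X_def field_simps)
  have "a * X \<le> (c * X) * X" using X by (intro mult_right_mono) auto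
  also have "\<dots> \<le> (c * X) * X * X" using X c by simp
  also have "\<dots> = c * X ^ 3" by (simp add: power3_eq_cube)
  finally have fX: "f X < 0" using b by (simp add: f_def)
  obtain \<gamma> where "1 \<le> \<gamma>" and f\<gamma>: "f \<gamma> = 0"
    using IVT2[of f X 0 1] fX f1 X(1) cont by auto
  with f1 have \<gamma>: "1 < \<gamma>" by (auto simp: less_le)
  \<comment> \<open>The difference of the two root equations; cancelling
    \<open>\<gamma> - \<beta>\<close> determines \<open>a\<close>, and then one root equation
    determines \<open>b\<close>.\<close>
  have "(\<gamma> - \<beta>) * a = (\<gamma> - \<beta>) * (c * (\<beta>\<^sup>2 + \<beta> * \<gamma> + \<gamma>\<^sup>2))"
    using f\<beta> f\<gamma> unfolding f_def by algebra
  then have a': "a = c * (\<beta>\<^sup>2 + \<beta> * \<gamma> + \<gamma>\<^sup>2)" using \<beta> \<gamma> by simp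
  then have b': "b = c * \<beta> * \<gamma> * (\<beta> + \<gamma>)" using f\<beta> unfolding f_def by algebra
  have "- c * x ^ 3 + a * x - b = - c * ((x - (- (\<beta> + \<gamma>))) * (x - \<beta>) * (x - \<gamma>))" for x
    unfolding a' b' by algebra
  then have "{x. - c * x ^ 3 + a * x - b = 0} = {- (\<beta> + \<gamma>), \<beta>, \<gamma>}" using c by auto
  with that \<beta> \<gamma> a' b' show thesis by blast
qed

lemma jacobi_at_0:
  assumes m: "0 \<le> m" "m < 1"
  shows "jacobi_sn 0 m = 0" "jacobi_cn 0 m = 1" "jacobi_dn 0 m = 1"
  by (simp_all add: jacobi_sn_def jacobi_cn_def jacobi_dn_def jacobi_am_0[OF m])

text \<open>\<open>i\<close> stands for \<open>I 0\<close>, and its square is the value of the cubic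
  at 1. The condition \<open>w 0 = 1\<close> fixes \<open>sn\<^sup>2\<close> and with it
  \<open>\<bar>i\<bar>\<close>; the sign goes into the phase, since \<open>sn\<close> is odd while
  \<open>cn\<close> and \<open>dn\<close> are even.\<close>

lemma jacobi_sn_initial_phase:
  assumes c: "c > 0" and \<beta>: "0 < \<beta>" "\<beta> < 1" and \<gamma>: "1 < \<gamma>" and \<alpha>: "\<alpha> = - (\<beta> + \<gamma>)"
    and m: "m = (\<gamma> - \<beta>) * (- \<alpha>) / (\<gamma> * (\<beta> - \<alpha>))"
    and k: "k = sqrt (c * \<gamma> * (\<beta> - \<alpha>))"
    and \<tau>0: "\<tau>0 = sgn i * jacobi_sn_inv (sqrt (\<gamma> * (1 - \<beta>) / (\<gamma> - \<beta>))) m"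
    and i: "i\<^sup>2 = c * (1 - \<beta>) * (\<gamma> - 1) * (1 + \<beta> + \<gamma>)"
  shows "\<gamma> - (\<gamma> - \<beta>) * (jacobi_sn \<tau>0 m)\<^sup>2 = \<beta> * \<gamma>"
    and "i = k * (\<gamma> - \<beta>) * (jacobi_sn \<tau>0 m * (jacobi_cn \<tau>0 m * jacobi_dn \<tau>0 m) / (\<beta> * \<gamma>))"
proof -
  define y where "y = sqrt (\<gamma> * (1 - \<beta>) / (\<gamma> - \<beta>))"
  define \<tau>1 where "\<tau>1 = jacobi_sn_inv y m"
  have m01: "0 \<le> m" "m < 1"
    using jacobi_parameter_range[of \<alpha> \<beta> \<gamma>] \<beta> \<gamma> unfolding m \<alpha> by simp_all
  have pos: "\<gamma> - \<beta> > 0" "2 * \<beta> + \<gamma> > 0" using \<beta> \<gamma> by simp_all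
  have m': "m * (\<gamma> * (2 * \<beta> + \<gamma>)) = (\<gamma> - \<beta>) * (\<beta> + \<gamma>)"
  proof -
    have "\<beta> - \<alpha> = 2 * \<beta> + \<gamma>" "- \<alpha> = \<beta> + \<gamma>" by (simp_all add: \<alpha>)
    then show ?thesis unfolding m using \<gamma> pos by (simp only:) simp
  qed
  have "\<beta> \<le> \<beta> * \<gamma>" using \<beta> \<gamma> by simp
  then have "\<gamma> * (1 - \<beta>) / (\<gamma> - \<beta>) \<le> 1" using pos by (simp add: algebra_simps)
  then have y: "0 \<le> y" "y \<le> 1" unfolding y_def using \<beta> \<gamma> by simp_all
  have y2: "(\<gamma> - \<beta>) * y\<^sup>2 = \<gamma> * (1 - \<beta>)" unfolding y_def using \<beta> \<gamma> pos by simp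
  have sn: "jacobi_sn \<tau>1 m = y" and cn: "jacobi_cn \<tau>1 m \<ge> 0"
    unfolding \<tau>1_def using jacobi_sn_inv_props[OF m01 y] by simp_all
  have "i\<^sup>2 > 0" unfolding i using c \<beta> \<gamma> by simp
  then have "i \<noteq> 0" by auto
  then have "\<tau>0 = \<tau>1 \<and> i > 0 \<or> \<tau>0 = - \<tau>1 \<and> i < 0"
    unfolding \<tau>0 y_def[symmetric] \<tau>1_def[symmetric] by (auto simp: sgn_if)
  then have sn0: "jacobi_sn \<tau>0 m = sgn i * y" and cn0: "jacobi_cn \<tau>0 m = jacobi_cn \<tau>1 m"
    and dn0: "jacobi_dn \<tau>0 m = jacobi_dn \<tau>1 m"
    using sn by (auto simp: jacobi_sn_def jacobi_cn_def jacobi_dn_def jacobi_am_minus[OF m01])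
  have "(jacobi_sn \<tau>0 m)\<^sup>2 = y\<^sup>2"
    using \<open>i \<noteq> 0\<close> by (simp add: sn0 sgn_if)
  then show "\<gamma> - (\<gamma> - \<beta>) * (jacobi_sn \<tau>0 m)\<^sup>2 = \<beta> * \<gamma>"
    using y2 by (simp add: algebra_simps)
  \<comment> \<open>The value of the formula for \<open>I\<close> at the phase
    \<open>\<tau>1\<close>. It is nonnegative because \<open>cn\<close> is, so comparing squares
    suffices for \<open>X = \<bar>i\<bar>\<close>.\<close>
  define X where "X = k * (\<gamma> - \<beta>) * (y * (jacobi_cn \<tau>1 m * jacobi_dn \<tau>1 m) / (\<beta> * \<gamma>))"
  have k2: "k\<^sup>2 = c * (\<gamma> * (2 * \<beta> + \<gamma>))" "k \<ge> 0"
    using c \<gamma> pos by (simp_all add: k \<alpha>)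
  have "X \<ge> 0"
    unfolding X_def using k2 \<beta> \<gamma> pos y cn jacobi_dn_pos[OF m01, of \<tau>1] by simp
  have "X * (\<beta> * \<gamma>) = k * (\<gamma> - \<beta>) * (y * (jacobi_cn \<tau>1 m * jacobi_dn \<tau>1 m))"
    unfolding X_def using \<beta> \<gamma> by simp
  then have "X\<^sup>2 * (\<beta> * \<gamma>)\<^sup>2 = k\<^sup>2 * (\<gamma> - \<beta>)\<^sup>2 * (y\<^sup>2 * (jacobi_cn \<tau>1 m * jacobi_dn \<tau>1 m)\<^sup>2)"
    by algebra
  also have "\<dots> = c * ((\<gamma> - \<beta>) * y\<^sup>2) * ((\<gamma> - \<beta>) - (\<gamma> - \<beta>) * y\<^sup>2) *
      (\<gamma> * (2 * \<beta> + \<gamma>) - m * (\<gamma> * (2 * \<beta> + \<gamma>)) * y\<^sup>2)"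
    unfolding jacobi_sn_deriv_sq[OF m01] sn k2 by algebra
  also have "\<dots> = c * ((\<gamma> - \<beta>) * y\<^sup>2) * ((\<gamma> - \<beta>) - (\<gamma> - \<beta>) * y\<^sup>2) *
      (\<gamma> * (2 * \<beta> + \<gamma>) - (\<beta> + \<gamma>) * ((\<gamma> - \<beta>) * y\<^sup>2))"
    unfolding m' by algebra
  also have "\<dots> = (c * (1 - \<beta>) * (\<gamma> - 1) * (1 + \<beta> + \<gamma>)) * (\<beta> * \<gamma>)\<^sup>2"
    unfolding y2 by algebra
  finally have "X\<^sup>2 = i\<^sup>2" unfolding i using \<beta> \<gamma> by simp
  then have "X = \<bar>i\<bar>" using \<open>X \<ge> 0\<close> by (metis real_sqrt_abs abs_of_nonneg)
  then have "sgn i * X = i" by (simp only: sgn_mult_abs)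
  moreover have "k * (\<gamma> - \<beta>) * (sgn i * y * (jacobi_cn \<tau>1 m * jacobi_dn \<tau>1 m) / (\<beta> * \<gamma>)) = sgn i * X"
    unfolding X_def by simp
  ultimately show "i = k * (\<gamma> - \<beta>) * (jacobi_sn \<tau>0 m * (jacobi_cn \<tau>0 m * jacobi_dn \<tau>0 m) / (\<beta> * \<gamma>))"
    unfolding sn0 cn0 dn0 by (simp only:)
qed

section \<open>Assembly of the cases from the explicit solutions and uniqueness\<close>

theorem proposition2p21:
  fixes p1 p3 \<rho> cp cm :: real
    and J :: "real set"
    and D R I :: "real \<Rightarrow> real"
  assumes "p3 > 0" and "p1 = 1/3 * p3" and "\<rho> > 0"
    and "is_interval J" and "0 \<in> J"
    and "solves_system p1 p3 J D R I"
    and "(D 0, R 0, I 0) \<in> sphere2 \<rho>"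
    and "cp = 1/2 * (D 0 - R 0)\<^sup>2" and "cm = 1/2 * (D 0 + R 0)\<^sup>2"
  shows
    \<comment> \<open>(1)\<close>
    "(cp = 0 \<and> cm = 0 \<longrightarrow>
        (\<forall>\<tau>\<in>J. (D \<tau>, R \<tau>, I \<tau>) = (0, 0, sgn (I 0) * \<rho>)))
     \<and>
     \<comment> \<open>(2)\<close>
     (cp = 0 \<and> 0 < cm \<longrightarrow>
        (let \<tau>0 = artanh (I 0 / \<rho>) in
           \<tau>0 = sgn (I 0) * arcosh (\<rho> / (sqrt 2 * \<bar>D 0\<bar>)) \<and>
           (\<forall>\<tau>\<in>J.
              D \<tau> = sgn (D 0) * (\<rho> / (sqrt 2 * cosh (4/3 * p3 * \<rho> * \<tau> + \<tau>0))) \<and>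
              R \<tau> = D \<tau> \<and>
              I \<tau> = \<rho> * tanh (4/3 * p3 * \<rho> * \<tau> + \<tau>0))))
     \<and>
     \<comment> \<open>(3)\<close>
     (cp > 0 \<and> cm = 0 \<longrightarrow>
        (let \<tau>0 = artanh (I 0 / \<rho>) in
           \<tau>0 = sgn (I 0) * arcosh (\<rho> / (sqrt 2 * \<bar>D 0\<bar>)) \<and>
           (\<forall>\<tau>\<in>J.
              D \<tau> = sgn (D 0) * (\<rho> / (sqrt 2 * cosh (8/3 * p3 * \<rho> * \<tau> - \<tau>0))) \<and>
              R \<tau> = - D \<tau> \<and>
              I \<tau> = - \<rho> * tanh (8/3 * p3 * \<rho> * \<tau> - \<tau>0))))
     \<and>
     \<comment> \<open>(4a)\<close>
     (cp > 0 \<and> cm > 0 \<and> I 0 = 0 \<and> 2 * cp = cm \<longrightarrow>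
        (\<exists>v \<in> {((sqrt 2 - 1) / sqrt 6 * \<rho>, (sqrt 2 + 1) / sqrt 6 * \<rho>, 0),
               - ((sqrt 2 - 1) / sqrt 6 * \<rho>, (sqrt 2 + 1) / sqrt 6 * \<rho>, 0),
               ((sqrt 2 + 1) / sqrt 6 * \<rho>, (sqrt 2 - 1) / sqrt 6 * \<rho>, 0),
               - ((sqrt 2 + 1) / sqrt 6 * \<rho>, (sqrt 2 - 1) / sqrt 6 * \<rho>, 0)}.
           \<forall>\<tau>\<in>J. (D \<tau>, R \<tau>, I \<tau>) = v))
     \<and>
     \<comment> \<open>(4b)\<close>
     (cp > 0 \<and> cm > 0 \<and> I 0 = 0 \<and> 2 * cp > cm \<longrightarrow>
        (let \<alpha> = - 1/2 - sqrt (cp * (cp + 4 * cm)) / (2 * cp);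
             \<beta> = - 1/2 + sqrt (cp * (cp + 4 * cm)) / (2 * cp);
             m = - \<alpha> * (1 - \<beta>) / (\<beta> - \<alpha>);
             u = (\<lambda>\<tau>. 4/3 * p3 * sqrt (cp * (\<beta> - \<alpha>)) * \<tau>);
             w = (\<lambda>\<tau>. \<beta> / (1 - (1 - \<beta>) * (jacobi_cd (u \<tau>) m)\<^sup>2))
         in
           \<alpha> \<in> {-2<..<-1} \<and> \<beta> \<in> {0<..<1} \<and>
           {x. cp * x\<^sup>2 + cp * x - cm = 0} = {\<alpha>, \<beta>} \<and>
           m \<in> {0..<1} \<and>
           (\<forall>\<tau>\<in>J.
              D \<tau> = (D 0 + R 0) / 2 * w \<tau> powr (-1/2) + (D 0 - R 0) / 2 * w \<tau> \<and>
              R \<tau> = (D 0 + R 0) / 2 * w \<tau> powr (-1/2) - (D 0 - R 0) / 2 * w \<tau> \<and>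
              I \<tau> = - sqrt (cp / (\<beta> - \<alpha>)) * \<beta> * (1 - \<alpha>) * (1 - \<beta>) *
                ((jacobi_cd (u \<tau>) m * jacobi_sd (u \<tau>) m * jacobi_nd (u \<tau>) m) /
                 (1 - (1 - \<beta>) * (jacobi_cd (u \<tau>) m)\<^sup>2)))))
     \<and>
     \<comment> \<open>(4c)\<close>
     (cp > 0 \<and> cm > 0 \<and> I 0 = 0 \<and> 2 * cp < cm \<longrightarrow>
        (let \<alpha> = - 1/2 - sqrt (cp * (cp + 4 * cm)) / (2 * cp);
             \<gamma> = - 1/2 + sqrt (cp * (cp + 4 * cm)) / (2 * cp);
             m = (\<gamma> - 1) * (- \<alpha>) / (\<gamma> * (1 - \<alpha>));
             u = (\<lambda>\<tau>. 4/3 * p3 * sqrt (cp * \<gamma> * (1 - \<alpha>)) * \<tau>);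
             w = (\<lambda>\<tau>. \<gamma> / (\<gamma> - (\<gamma> - 1) * (jacobi_sn (u \<tau>) m)\<^sup>2))
         in
           \<alpha> < -2 \<and> \<gamma> > 1 \<and>
           {x. cp * x\<^sup>2 + cp * x - cm = 0} = {\<alpha>, \<gamma>} \<and>
           m \<in> {0..<1} \<and>
           (\<forall>\<tau>\<in>J.
              D \<tau> = (D 0 + R 0) / 2 * w \<tau> powr (-1/2) + (D 0 - R 0) / 2 * w \<tau> \<and>
              R \<tau> = (D 0 + R 0) / 2 * w \<tau> powr (-1/2) - (D 0 - R 0) / 2 * w \<tau> \<and>
              I \<tau> = sqrt (cp * \<gamma> * (1 - \<alpha>)) * (\<gamma> - 1) *
                ((jacobi_sn (u \<tau>) m * jacobi_cn (u \<tau>) m * jacobi_dn (u \<tau>) m) /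
                 (\<gamma> - (\<gamma> - 1) * (jacobi_sn (u \<tau>) m)\<^sup>2)))))
     \<and>
     \<comment> \<open>(5)\<close>
     (cp > 0 \<and> cm > 0 \<and> I 0 \<noteq> 0 \<longrightarrow>
        (\<exists>\<alpha> \<beta> \<gamma>.
           \<alpha> < 0 \<and> \<beta> \<in> {0<..<1} \<and> \<gamma> > 1 \<and>
           {x. - cp * x ^ 3 + \<rho>\<^sup>2 * x - cm = 0} = {\<alpha>, \<beta>, \<gamma>} \<and>
           (let m = (\<gamma> - \<beta>) * (- \<alpha>) / (\<gamma> * (\<beta> - \<alpha>));
                \<tau>0 = sgn (I 0) * jacobi_sn_inv (sqrt (\<gamma> * (1 - \<beta>) / (\<gamma> - \<beta>))) m;
                u = (\<lambda>\<tau>. 4/3 * p3 * sqrt (cp * \<gamma> * (\<beta> - \<alpha>)) * \<tau> + \<tau>0);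
                w = (\<lambda>\<tau>. \<beta> * \<gamma> / (\<gamma> - (\<gamma> - \<beta>) * (jacobi_sn (u \<tau>) m)\<^sup>2))
            in
              m \<in> {0..<1} \<and>
              (\<forall>\<tau>\<in>J.
                 D \<tau> = (D 0 + R 0) / 2 * w \<tau> powr (-1/2) + (D 0 - R 0) / 2 * w \<tau> \<and>
                 R \<tau> = (D 0 + R 0) / 2 * w \<tau> powr (-1/2) - (D 0 - R 0) / 2 * w \<tau> \<and>
                 I \<tau> = sqrt (cp * \<gamma> * (\<beta> - \<alpha>)) * (\<gamma> - \<beta>) *
                   ((jacobi_sn (u \<tau>) m * jacobi_cn (u \<tau>) m * jacobi_dn (u \<tau>) m) /
                    (\<gamma> - (\<gamma> - \<beta>) * (jacobi_sn (u \<tau>) m)\<^sup>2))))))"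
proof -
  note p1 = assms(2) and cp_eq = assms(8) and cm_eq = assms(9)
  note sol = assms(6) and J = assms(4,5)
  note sol' = sol[unfolded p1]
  have energy: "(D 0)\<^sup>2 + (R 0)\<^sup>2 + (I 0)\<^sup>2 = \<rho>\<^sup>2"
    using assms(7) by (simp add: sphere2_def)
  have T: "(D 0 - R 0)\<^sup>2 = 2 * cp" and S: "(D 0 + R 0)\<^sup>2 = 2 * cm"
    using cp_eq cm_eq by simp_all
  have energy': "cp + cm + (I 0)\<^sup>2 = \<rho>\<^sup>2"
    using energy S T by (simp add: power2_sum power2_diff)
  show ?thesis
  \<comment> \<open>The goals 1 to 7 are (1), (2), (3), (4a), (4b), (4c), (5) in this order.\<close>
  proof (intro conjI impI, goal_cases)
    case 1
    then have z: "D 0 = 0" "R 0 = 0" using S T by auto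
    then have "(I 0)\<^sup>2 = \<rho>\<^sup>2" using energy by simp
    then have "\<bar>I 0\<bar> = \<rho>" using \<open>\<rho> > 0\<close> by (auto simp: power2_eq_iff)
    then have I0: "sgn (I 0) * \<rho> = I 0" using sgn_mult_abs[of "I 0"] by simp
    \<comment> \<open>The poles of the sphere are equilibria, and the initial point is one of
      them.\<close>
    have "solves_system p1 p3 J (\<lambda>_. 0) (\<lambda>_. 0) (\<lambda>_. sgn (I 0) * \<rho>)"
      by (simp add: solves_system_def)
    from solves_system_unique[OF sol this J] show ?case
      using z I0 by simp
  next
    case 2
    then have R0: "R 0 = 1 * D 0" using T by simp
    with 2 have "D 0 \<noteq> 0" using S by auto
    note hyp = hyperbolic_solution[OF sol J one_power2 R0 this \<open>\<rho> > 0\<close> energy refl]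
    \<comment> \<open>For \<open>e = 1\<close> the rate \<open>k\<close> is
      \<open>- 4/3 * p3\<close>.\<close>
    have arg: "\<tau>0 - 2 * (p1 - 1 * p3) * \<rho> * \<tau> = 4/3 * p3 * \<rho> * \<tau> + \<tau>0" for \<tau>0 \<tau>
      unfolding p1 by (simp add: field_simps)
    show ?case
      unfolding Let_def using hyp(1) hyp(2)[unfolded arg] by simp
  next
    case 3
    then have R0: "R 0 = - 1 * D 0" using S by simp
    with 3 have "D 0 \<noteq> 0" using T by auto
    note hyp = hyperbolic_solution[OF sol J _ R0 this \<open>\<rho> > 0\<close> energy refl]
    \<comment> \<open>For \<open>e = - 1\<close> the rate \<open>k\<close> is
      \<open>8/3 * p3\<close>. The argument comes out negated, which the parities of
      \<open>cosh\<close> and \<open>tanh\<close> absorb.\<close>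
    have arg: "\<tau>0 - 2 * (p1 - - 1 * p3) * \<rho> * \<tau> = - (8/3 * p3 * \<rho> * \<tau> - \<tau>0)" for \<tau>0 \<tau>
      unfolding p1 by (simp add: field_simps)
    show ?case
      unfolding Let_def using hyp(1) hyp(2)[unfolded arg cosh_minus tanh_minus] by simp
  next
    case 4
    \<comment> \<open>The solution of \<open>(a + b)\<^sup>2 = 2 * cm\<close> and
      \<open>(b - a)\<^sup>2 = 2 * cp\<close> when \<open>cm = 2 * cp\<close> and
      \<open>3 * cp = \<rho>\<^sup>2\<close>. The four choices of signs for \<open>D 0 + R 0\<close>
      and \<open>D 0 - R 0\<close> give the four points.\<close>
    define a b where "a = (sqrt 2 - 1) / sqrt 6 * \<rho>" and "b = (sqrt 2 + 1) / sqrt 6 * \<rho>"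
    have "3 * cp = \<rho>\<^sup>2" "cm = 2 * cp" using 4 energy' by simp_all
    moreover have "(a + b)\<^sup>2 = 4/3 * \<rho>\<^sup>2" "(b - a)\<^sup>2 = 2/3 * \<rho>\<^sup>2"
    proof -
      have "a + b = 2 * sqrt 2 / sqrt 6 * \<rho>" "b - a = 2 / sqrt 6 * \<rho>"
        by (simp_all add: a_def b_def field_simps)
      then show "(a + b)\<^sup>2 = 4/3 * \<rho>\<^sup>2" "(b - a)\<^sup>2 = 2/3 * \<rho>\<^sup>2"
        by (simp_all add: power_mult_distrib power_divide)
    qed
    ultimately have "(D 0 + R 0)\<^sup>2 = (a + b)\<^sup>2" "(D 0 - R 0)\<^sup>2 = (b - a)\<^sup>2"
      using S T by simp_all
    then have "(D 0 = a \<and> R 0 = b) \<or> (D 0 = - a \<and> R 0 = - b) \<or> (D 0 = b \<and> R 0 = a) \<or> (D 0 = - b \<and> R 0 = - a)"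
      unfolding power2_eq_iff by (smt (verit))
    moreover have "\<forall>\<tau>\<in>J. (D \<tau>, R \<tau>, I \<tau>) = (D 0, R 0, 0)"
    proof -
      \<comment> \<open>The derivative of \<open>I\<close> is a multiple of
        \<open>(D + R)\<^sup>2 - 2 * (D - R)\<^sup>2\<close>, so here the initial point is an
        equilibrium.\<close>
      have "2 * (D 0 - R 0)\<^sup>2 = (D 0 + R 0)\<^sup>2" using 4 S T by simp
      then have z: "- 2 * p1 * ((D 0)\<^sup>2 + (R 0)\<^sup>2) + 4 * p3 * D 0 * R 0 = 0"
        unfolding p1 by (simp add: power2_sum power2_diff)
      have "solves_system p1 p3 J (\<lambda>_. D 0) (\<lambda>_. R 0) (\<lambda>_. 0)"
        unfolding solves_system_def z by simp
      from solves_system_unique[OF sol this J] show ?thesis using 4 by simp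
    qed
    ultimately show ?case
      unfolding a_def[symmetric] b_def[symmetric] by auto
  next
    case 5
    define \<alpha> \<beta> where "\<alpha> = - 1/2 - sqrt (cp * (cp + 4 * cm)) / (2 * cp)"
      and "\<beta> = - 1/2 + sqrt (cp * (cp + 4 * cm)) / (2 * cp)"
    define m where "m = - \<alpha> * (1 - \<beta>) / (\<beta> - \<alpha>)"
    have c: "cp > 0" "cm > 0" using 5 by simp_all
    note roots = quadratic_roots[OF c \<alpha>_def \<beta>_def]
    have "cp * (\<beta> * (\<beta> + 1)) = cm" using roots(2) by (simp only: mult.assoc)
    then have "cp * (\<beta> * (\<beta> + 1)) < cp * 2" using 5 by linarith
    then have "\<beta> * (\<beta> + 1) < 2" using c by simp
    \<comment> \<open>Otherwise \<open>\<beta> * (\<beta> + 1)\<close> would be at least 2.\<close>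
    then have "\<beta> < 1" using mult_mono[of 1 \<beta> 2 "\<beta> + 1"] by (cases "\<beta> < 1") auto
    \<comment> \<open>The general shape of the parameter with \<open>\<gamma> = 1\<close>: this case
      is the instance \<open>\<gamma> = 1\<close>, \<open>q = cd\<close>, phase 0 of
      \<open>elliptic_solution\<close>.\<close>
    have m: "m = (1 - \<beta>) * (- \<alpha>) / (1 * (\<beta> - \<alpha>))" by (simp add: m_def mult.commute)
    have m01: "0 \<le> m" "m < 1"
      using jacobi_parameter_range[of \<alpha> \<beta> 1] roots(1,3) \<open>\<beta> < 1\<close> unfolding m by simp_all
    have pos: "\<beta> - \<alpha> > 0" using roots(1,3) by simp
    have s: "(D 0 + R 0)\<^sup>2 = 2 * cp * \<beta> * 1 * (\<beta> + 1)" using S roots(2) by simp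
    \<comment> \<open>\<open>cd = 1\<close> gives \<open>w 0 = 1\<close>, and \<open>sd = 0\<close>
      matches \<open>I 0 = 0\<close>.\<close>
    have "jacobi_cd 0 m = 1" "jacobi_sd 0 m = 0"
      using jacobi_at_0[OF m01] by (simp_all add: jacobi_cd_def jacobi_sd_def)
    then have init: "1 - (1 - \<beta>) * (jacobi_cd 0 m)\<^sup>2 = \<beta> * 1"
      "I 0 = sqrt (cp * 1 * (\<beta> - \<alpha>)) * (1 - \<beta>) *
        (jacobi_cd 0 m * (- (1 - m) * (jacobi_sd 0 m * jacobi_nd 0 m)) / (\<beta> * 1))"
      using 5 by simp_all
    note ell = elliptic_solution[OF sol' J c(1) roots(3) less_imp_le[OF \<open>\<beta> < 1\<close>] roots(1) m s T
        jacobi_cd_has_derivative[OF m01] jacobi_cd_has_second_derivative[OF m01]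
        jacobi_cd_deriv_sq[OF m01] jacobi_cd_le[OF m01] refl refl refl init,
        unfolded mult_1_right mult_1_left add_0_right]
    have "sqrt (cp * (\<beta> - \<alpha>)) = sqrt (cp / (\<beta> - \<alpha>) * (\<beta> - \<alpha>)\<^sup>2)"
      using pos by (simp add: power2_eq_square)
    also have "\<dots> = sqrt (cp / (\<beta> - \<alpha>)) * (\<beta> - \<alpha>)"
      using pos by (simp only: real_sqrt_mult real_sqrt_abs abs_of_pos)
    finally have k: "sqrt (cp * (\<beta> - \<alpha>)) = sqrt (cp / (\<beta> - \<alpha>)) * (\<beta> - \<alpha>)" .
    have "(\<beta> - \<alpha>) * m = - \<alpha> * (1 - \<beta>)" unfolding m_def using pos by simp
    then have m': "(\<beta> - \<alpha>) * (1 - m) = \<beta> * (1 - \<alpha>)" by algebra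
    \<comment> \<open>The factor \<open>1 - m\<close> in the derivative of \<open>cd\<close> is
      traded for roots through \<open>m'\<close>, and the square root is rewritten by
      \<open>k\<close>; this yields the constant of the claim.\<close>
    have I_eq: "sqrt (cp * (\<beta> - \<alpha>)) * (1 - \<beta>) * (x * (- (1 - m) * (y * z)) / e) =
      - sqrt (cp / (\<beta> - \<alpha>)) * \<beta> * (1 - \<alpha>) * (1 - \<beta>) * ((x * y * z) / e)" for x y z e
    proof -
      have "sqrt (cp * (\<beta> - \<alpha>)) * (1 - \<beta>) * (x * (- (1 - m) * (y * z)) / e) =
          - sqrt (cp / (\<beta> - \<alpha>)) * ((\<beta> - \<alpha>) * (1 - m)) * (1 - \<beta>) * ((x * y * z) / e)"
        unfolding k
        using minus_mult_left[of "1 - m" "y * z"] by (simp del: minus_diff_eq)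
      then show ?thesis unfolding m' by simp
    qed
    have ranges: "\<alpha> \<in> {-2<..<-1}" "\<beta> \<in> {0<..<1}" "m \<in> {0..<1}"
      using roots(1,3) \<open>\<beta> < 1\<close> m01 by simp_all
    show ?case
      unfolding Let_def \<alpha>_def[symmetric] \<beta>_def[symmetric]
      unfolding m_def[symmetric]
      by (intro conjI ranges roots(4), intro ballI, erule ell[unfolded I_eq])
  next
    case 6
    define \<alpha> \<gamma> where "\<alpha> = - 1/2 - sqrt (cp * (cp + 4 * cm)) / (2 * cp)"
      and "\<gamma> = - 1/2 + sqrt (cp * (cp + 4 * cm)) / (2 * cp)"
    define m where "m = (\<gamma> - 1) * (- \<alpha>) / (\<gamma> * (1 - \<alpha>))"
    have c: "cp > 0" "cm > 0" using 6 by simp_all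
    note roots = quadratic_roots[OF c \<alpha>_def \<gamma>_def]
    have "cp * (\<gamma> * (\<gamma> + 1)) = cm" using roots(2) by (simp only: mult.assoc)
    then have "cp * 2 < cp * (\<gamma> * (\<gamma> + 1))" using 6 by linarith
    then have "2 < \<gamma> * (\<gamma> + 1)" using c by simp
    then have "\<gamma> > 1" using mult_mono[of \<gamma> 1 "\<gamma> + 1" 2] roots(3) by (cases "\<gamma> > 1") auto
    \<comment> \<open>The root 1 of the cubic is now the smaller positive one: this case is the
      instance \<open>\<beta> = 1\<close>, \<open>q = sn\<close>, phase 0.\<close>
    have \<alpha>: "\<alpha> = - (1 + \<gamma>)" using roots(1) by simp
    have m01: "0 \<le> m" "m < 1"
      using jacobi_parameter_range[of \<alpha> 1 \<gamma>] \<alpha> \<open>\<gamma> > 1\<close> unfolding m_def by simp_all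
    have s: "(D 0 + R 0)\<^sup>2 = 2 * cp * 1 * \<gamma> * (1 + \<gamma>)" using S roots(2) by (simp add: algebra_simps)
    have init: "\<gamma> - (\<gamma> - 1) * (jacobi_sn 0 m)\<^sup>2 = 1 * \<gamma>"
      "I 0 = sqrt (cp * \<gamma> * (1 - \<alpha>)) * (\<gamma> - 1) *
        (jacobi_sn 0 m * (jacobi_cn 0 m * jacobi_dn 0 m) / (1 * \<gamma>))"
      using 6 jacobi_at_0[OF m01] by simp_all
    note ell = elliptic_solution[OF sol' J c(1) zero_less_one less_imp_le[OF \<open>\<gamma> > 1\<close>] \<alpha> m_def s T
        jacobi_sn_has_derivative[OF m01] jacobi_sn_has_second_derivative[OF m01]
        jacobi_sn_deriv_sq[OF m01] jacobi_sn_le[OF m01] refl refl refl init,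
        unfolded mult_1_left add_0_right mult.assoc[symmetric]]
    have ranges: "\<alpha> < -2" "m \<in> {0..<1}"
      using \<alpha> \<open>\<gamma> > 1\<close> m01 by simp_all
    show ?case
      unfolding Let_def \<alpha>_def[symmetric] \<gamma>_def[symmetric]
      unfolding m_def[symmetric]
      by (intro conjI ranges \<open>\<gamma> > 1\<close> roots(4), intro ballI, erule ell)
  next
    case 7
    then have c: "cp > 0" "cm > 0" and "(I 0)\<^sup>2 > 0" by simp_all
    \<comment> \<open>This is positivity of the cubic at 1, which puts 1 strictly between the two
      positive roots.\<close>
    then have "cp + cm < \<rho>\<^sup>2" using energy' by linarith
    from cubic_roots[OF c this] obtain \<beta> \<gamma> where
      \<beta>: "0 < \<beta>" "\<beta> < 1" and \<gamma>: "1 < \<gamma>" and \<rho>: "\<rho>\<^sup>2 = cp * (\<beta>\<^sup>2 + \<beta> * \<gamma> + \<gamma>\<^sup>2)"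
      and cm: "cm = cp * \<beta> * \<gamma> * (\<beta> + \<gamma>)"
      and roots: "{x. - cp * x ^ 3 + \<rho>\<^sup>2 * x - cm = 0} = {- (\<beta> + \<gamma>), \<beta>, \<gamma>}" .
    define \<alpha> where "\<alpha> = - (\<beta> + \<gamma>)"
    define m where "m = (\<gamma> - \<beta>) * (- \<alpha>) / (\<gamma> * (\<beta> - \<alpha>))"
    define \<tau>0 where "\<tau>0 = sgn (I 0) * jacobi_sn_inv (sqrt (\<gamma> * (1 - \<beta>) / (\<gamma> - \<beta>))) m"
    have "\<beta> \<le> \<gamma>" "\<alpha> < 0" using \<beta> \<gamma> by (simp_all add: \<alpha>_def)
    have m01: "0 \<le> m" "m < 1"
      using jacobi_parameter_range[OF \<open>\<alpha> < 0\<close> \<beta>(1) \<open>\<beta> \<le> \<gamma>\<close>] unfolding m_def by simp_all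
    have s: "(D 0 + R 0)\<^sup>2 = 2 * cp * \<beta> * \<gamma> * (\<beta> + \<gamma>)" using S cm by simp
    \<comment> \<open>The value \<open>\<rho>\<^sup>2 - cp - cm\<close> of the cubic at 1, factored
      by its roots.\<close>
    have "(I 0)\<^sup>2 = cp * (1 - \<beta>) * (\<gamma> - 1) * (1 + \<beta> + \<gamma>)"
      using energy' unfolding \<rho> cm by algebra
    note init = jacobi_sn_initial_phase[OF c(1) \<beta> \<gamma> \<alpha>_def m_def refl \<tau>0_def this]
    note ell = elliptic_solution[OF sol' J c(1) \<beta>(1) \<open>\<beta> \<le> \<gamma>\<close> \<alpha>_def m_def s T
        jacobi_sn_has_derivative[OF m01] jacobi_sn_has_second_derivative[OF m01]
        jacobi_sn_deriv_sq[OF m01] jacobi_sn_le[OF m01] refl refl refl init,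
        unfolded mult.assoc[symmetric]]
    have ranges: "\<beta> \<in> {0<..<1}" "m \<in> {0..<1}" using \<beta> m01 by simp_all
    show ?case
    proof (intro exI)
      show "\<alpha> < 0 \<and> \<beta> \<in> {0<..<1} \<and> \<gamma> > 1 \<and>
        {x. - cp * x ^ 3 + \<rho>\<^sup>2 * x - cm = 0} = {\<alpha>, \<beta>, \<gamma>} \<and>
        (let m = (\<gamma> - \<beta>) * (- \<alpha>) / (\<gamma> * (\<beta> - \<alpha>));
             \<tau>0 = sgn (I 0) * jacobi_sn_inv (sqrt (\<gamma> * (1 - \<beta>) / (\<gamma> - \<beta>))) m;
             u = (\<lambda>\<tau>. 4/3 * p3 * sqrt (cp * \<gamma> * (\<beta> - \<alpha>)) * \<tau> + \<tau>0);
             w = (\<lambda>\<tau>. \<beta> * \<gamma> / (\<gamma> - (\<gamma> - \<beta>) * (jacobi_sn (u \<tau>) m)\<^sup>2))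
         in
           m \<in> {0..<1} \<and>
           (\<forall>\<tau>\<in>J.
              D \<tau> = (D 0 + R 0) / 2 * w \<tau> powr (-1/2) + (D 0 - R 0) / 2 * w \<tau> \<and>
              R \<tau> = (D 0 + R 0) / 2 * w \<tau> powr (-1/2) - (D 0 - R 0) / 2 * w \<tau> \<and>
              I \<tau> = sqrt (cp * \<gamma> * (\<beta> - \<alpha>)) * (\<gamma> - \<beta>) *
                ((jacobi_sn (u \<tau>) m * jacobi_cn (u \<tau>) m * jacobi_dn (u \<tau>) m) /
                 (\<gamma> - (\<gamma> - \<beta>) * (jacobi_sn (u \<tau>) m)\<^sup>2))))"
        unfolding Let_def m_def[symmetric] \<tau>0_def[symmetric]
        by (intro conjI ranges \<open>\<alpha> < 0\<close> \<gamma> roots[folded \<alpha>_def], intro ballI, erule ell)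
    qed
  qed
qed

end
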